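(* Let $m=m_n\to\infty$ and $p=p_n\to0$ satisfy $np=o(1)$, $mp^2=o(1)$, and $\mathbf{d}:=nmp^2\ge 1$. Then for any $A>0$ there exists a constant $C$ such that for any function $\omega=\omega_n\to\infty$, with high probability $$\operatorname{mod}(\mathcal{G}(n,m,p))\le \frac{C}{\sqrt{\mathbf{d}}}+O\left((np)^{A}+\omega mp^2\right).$$
   Context: The random intersection graph $\mathcal{G}(n,m,p)$: there is a vertex set $\mathcal{V}=\{v_1,\dots,v_n\}$ and an attribute set $\mathcal{W}=\{w_1,\dots,w_m\}$. Each vertex $v_i$ receives a random subset $\mathcal{W}(v_i)\subseteq\mathcal{W}$, where each attribute is included independently with probability $p$ (independently over all vertex–attribute pairs). Two distinct vertices are adjacent iff their attribute sets intersect. Modularity: for a graph $G$ with at least one edge, $e(G)$ is its number of edges, $e(S)$ the number of edges inside $S\subseteq V(G)$, $\operatorname{vol}(S)$ the sum of degrees of vertices of $S$, $\operatorname{vol}(G)=\operatorname{vol}(V(G))$; $\operatorname{mod}(G)=\max_{\mathcal{A}}\sum_{S\in\mathcal{A}}\left(\frac{e(S)}{e(G)}-\left(\frac{\operatorname{vol}(S)}{\operatorname{vol}(G)}\right)^2\right)$ over all partitions $\mathcal{A}$ of $V(G)$. "With high probability" means with probability tending to $1$ as $n\to\infty$. *)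

theory Defs
  imports "HOL-Probability.Probability" "HOL-Probability.Product_PMF"
    "HOL-Library.Landau_Symbols" "HOL-Library.Disjoint_Sets"
begin

(* A finite simple graph is a pair (V, E) of a vertex set and a set of edges, each edge being
   a two-element subset of V. *)
type_synonym 'a ugraph = "'a set \<times> 'a set set"

definition edges_within :: "'a ugraph \<Rightarrow> 'a set \<Rightarrow> nat" where
  "edges_within G S = card {e \<in> snd G. e \<subseteq> S}"

definition degree :: "'a ugraph \<Rightarrow> 'a \<Rightarrow> nat" where
  "degree G v = card {e \<in> snd G. v \<in> e}"

definition vol :: "'a ugraph \<Rightarrow> 'a set \<Rightarrow> nat" where
  "vol G S = (\<Sum>v\<in>S. degree G v)"

definition modularity_score :: "'a ugraph \<Rightarrow> 'a set set \<Rightarrow> real" where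
  "modularity_score G \<A> =
     (\<Sum>S\<in>\<A>. real (edges_within G S) / real (card (snd G))
            - (real (vol G S) / real (vol G (fst G)))\<^sup>2)"

(* Since x / 0 = 0, an edgeless graph has modularity 0. *)
definition modularity :: "'a ugraph \<Rightarrow> real" where
  "modularity G = Max {modularity_score G \<A> | \<A>. partition_on (fst G) \<A>}"

definition attributes :: "nat \<Rightarrow> (nat \<times> nat \<Rightarrow> bool) \<Rightarrow> nat \<Rightarrow> nat set" where
  "attributes m X v = {w \<in> {1..m}. X (v, w)}"

definition intersection_graph :: "nat \<Rightarrow> (nat \<Rightarrow> nat set) \<Rightarrow> nat ugraph" where
  "intersection_graph n W =
     ({1..n}, {{u, v} | u v. u \<in> {1..n} \<and> v \<in> {1..n} \<and> u \<noteq> v \<and> W u \<inter> W v \<noteq> {}})"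

(* X (v, w) says that vertex v has received attribute w; off the index set of the product,
   X is constantly False. *)
definition random_intersection_graph :: "nat \<Rightarrow> nat \<Rightarrow> real \<Rightarrow> nat ugraph pmf" where
  "random_intersection_graph n m p =
     map_pmf (\<lambda>X. intersection_graph n (attributes m X))
       (Pi_pmf ({1..n} \<times> {1..m}) False (\<lambda>_. bernoulli_pmf p))"

end

theory Submission
  imports Defs
begin

text \<open>
  Giving every part of a partition a suitable sign merges the parts into a \<open>\<plusminus>1\<close> vector without
  lowering the modularity form; completing the square then bounds the modularity by
  \<open>(1/e(G)) \<Sum> y u * y v\<close>, summed over the edges \<open>uv\<close>, where \<open>y\<close> is a centred sign vector, so only
  \<open>2^n\<close> vectors have to be considered. Up to edges arising from several attributes (Markov, giving the term
  \<open>\<omega> m p^2\<close>) the edge sum is a sum of independent contributions of the attributes. Attributes held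
  by more than a constant number \<open>K\<close> of vertices are removed (Markov again, giving the term \<open>(np)^A\<close>);
  the remaining contributions are bounded with essentially nonpositive mean, and an exponential
  moment bound at \<open>\<lambda> = 1/\<surd>d\<close> beats the union bound over all sign vectors.
\<close>

section \<open>Modularity and sign vectors\<close>

text \<open>With \<open>x = n * p\<close>, every quantity is measured against
  \<open>n * d = m * x^2\<close>, the order of the number of edges. Each sign vector must fail with
  probability well below \<open>2^-n\<close>; a deviation of order \<open>n * sqrt d\<close>
  achieves this, and dividing by \<open>n * d\<close> leaves \<open>1 / sqrt d\<close>. Two
  obstacles shape the argument. The volume term couples the score to the random degrees. Centring
  removes it and also fixes the mean: twice the sum of \<open>y u * y v\<close> over all pairs is
  the square of the sum of \<open>y\<close> minus the sum of squares, hence at most 0 when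
  \<open>y\<close> sums to 0. Secondly, an attribute with \<open>k\<close> holders contributes up to
  order \<open>k^2\<close>, which gives no useful exponential moment bound until \<open>k\<close> is
  capped. After capping, attributes with fewer than two holders still contribute nothing, so the
  second-order term per attribute is of order \<open>x^2\<close> and not merely bounded. The cap
  \<open>K\<close> costs order \<open>m * x^(K+1)\<close>, that is \<open>x^(K-1)\<close> relative
  to \<open>n * d\<close>. With \<open>K = a + 2\<close> and \<open>a >= A\<close> this is
  \<open>x^(a+1)\<close>, one factor \<open>x\<close> better than required; Markov's inequality
  spends that factor.\<close>

definition pairs :: "'a set \<Rightarrow> 'a set set" where
  "pairs A = {e. e \<subseteq> A \<and> card e = 2}"

text \<open>For finite \<open>A\<close> this is the second elementary symmetric polynomial in the
  values of \<open>y\<close> on \<open>A\<close>: the edge sum of a clique on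
  \<open>A\<close>.\<close>

definition pair_sum :: "('a \<Rightarrow> real) \<Rightarrow> 'a set \<Rightarrow> real" where
  "pair_sum y A = (\<Sum>e\<in>pairs A. \<Prod>u\<in>e. y u)"

definition centred_sign :: "'a set \<Rightarrow> 'a set \<Rightarrow> 'a \<Rightarrow> real" where
  "centred_sign V S v =
     (if v \<in> S then 1 else - 1) - (\<Sum>u\<in>V. if u \<in> S then 1 else - 1) / real (card V)"

lemma finite_pairs [intro]: "finite A \<Longrightarrow> finite (pairs A)"
  by (rule finite_subset[of _ "Pow A"]) (auto simp: pairs_def)

lemma card_pairs: "finite A \<Longrightarrow> card (pairs A) = card A choose 2"
  by (simp add: pairs_def n_subsets)

lemma pairs_insert:
  assumes "a \<notin> A"
  shows "pairs (insert a A) = pairs A \<union> (\<lambda>b. {a, b}) ` A"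
  using assms by (fastforce simp: pairs_def card_2_iff doubleton_eq_iff)

text \<open>Newton's identity for the second elementary symmetric polynomial. Its use is the sign:
  if \<open>y\<close> sums to 0 on \<open>A\<close>, the pair sum is nonpositive.\<close>

lemma pair_sum_eq:
  assumes "finite A"
  shows "2 * pair_sum y A = (\<Sum>u\<in>A. y u)\<^sup>2 - (\<Sum>u\<in>A. (y u)\<^sup>2)"
  using assms
proof (induction A rule: finite_induct)
  case empty
  have "pairs {} = ({} :: 'a set set)" by (auto simp: pairs_def)
  then show ?case by (simp add: pair_sum_def)
next
  case (insert a A)
  have disj: "pairs A \<inter> (\<lambda>b. {a, b}) ` A = {}"
    using insert.hyps by (auto simp: pairs_def)
  have inj: "inj_on (\<lambda>b. {a, b}) A"
    using insert.hyps by (auto simp: inj_on_def doubleton_eq_iff)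
  have "pair_sum y (insert a A) = pair_sum y A + (\<Sum>e\<in>(\<lambda>b. {a, b}) ` A. \<Prod>u\<in>e. y u)"
    using insert.hyps disj
    by (simp add: pair_sum_def pairs_insert finite_pairs sum.union_disjoint)
  also have "(\<Sum>e\<in>(\<lambda>b. {a, b}) ` A. \<Prod>u\<in>e. y u) = (\<Sum>b\<in>A. \<Prod>u\<in>{a, b}. y u)"
    using inj by (simp add: sum.reindex)
  also have "\<dots> = (\<Sum>b\<in>A. y a * y b)"
  proof (intro sum.cong refl)
    fix b assume "b \<in> A"
    then have "a \<noteq> b" using insert.hyps by auto
    then show "(\<Prod>u\<in>{a, b}. y u) = y a * y b" by simp
  qed
  also have "\<dots> = y a * (\<Sum>b\<in>A. y b)" by (simp add: sum_distrib_left)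
  finally show ?case using insert
    by (simp add: power2_eq_square algebra_simps)
qed

lemma abs_prod_pair_le:
  fixes y :: "'a \<Rightarrow> real"
  assumes "e \<in> pairs A" "\<And>u. u \<in> A \<Longrightarrow> \<bar>y u\<bar> \<le> c"
  shows "\<bar>\<Prod>u\<in>e. y u\<bar> \<le> c\<^sup>2"
proof -
  have "\<bar>\<Prod>u\<in>e. y u\<bar> = (\<Prod>u\<in>e. \<bar>y u\<bar>)" by (simp add: abs_prod)
  also have "\<dots> \<le> (\<Prod>u\<in>e. c)" using assms by (intro prod_mono) (auto simp: pairs_def)
  also have "\<dots> = c\<^sup>2" using assms(1) by (simp add: pairs_def)
  finally show ?thesis .
qed

lemma abs_pair_sum_le:
  assumes "finite A" "\<And>u. u \<in> A \<Longrightarrow> \<bar>y u\<bar> \<le> c"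
  shows "\<bar>pair_sum y A\<bar> \<le> c\<^sup>2 * real (card A choose 2)"
proof -
  have "\<bar>\<Prod>u\<in>e. y u\<bar> \<le> c\<^sup>2" if "e \<in> pairs A" for e
    using that assms(2) by (rule abs_prod_pair_le)
  then have "\<bar>pair_sum y A\<bar> \<le> (\<Sum>e\<in>pairs A. c\<^sup>2)"
    unfolding pair_sum_def by (intro order.trans[OF sum_abs] sum_mono) auto
  then show ?thesis using assms by (simp add: card_pairs mult.commute)
qed

lemma sum_centred_sign:
  assumes "finite V"
  shows "(\<Sum>v\<in>V. centred_sign V S v) = 0"
  using assms by (cases "V = {}") (simp_all add: centred_sign_def sum_subtractf)

lemma abs_centred_sign_le: "\<bar>centred_sign V S v\<bar> \<le> 2"
proof -
  have "\<bar>\<Sum>u\<in>V. if u \<in> S then 1 else - 1 :: real\<bar> \<le> (\<Sum>u\<in>V. 1)"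
    by (intro order.trans[OF sum_abs] sum_mono) auto
  then have "\<bar>(\<Sum>u\<in>V. if u \<in> S then 1 else - 1 :: real) / real (card V)\<bar> \<le> 1"
    by (cases "card V = 0") (auto simp: divide_simps)
  moreover have "\<bar>(if v \<in> S then 1 else - 1 :: real)\<bar> = 1" by simp
  ultimately show ?thesis unfolding centred_sign_def by linarith
qed

section \<open>Merging the parts of a partition into one sign vector\<close>

text \<open>Let \<open>x\<close> be the sign vector built so far. By the parallelogram law the
  average of \<open>q\<close> at \<open>x\<close> plus and at \<open>x\<close> minus the indicator
  of a new part equals \<open>q x\<close> plus the value at that indicator, so one of the two signs
  loses nothing. Disjointness keeps the entries at 1 or -1.\<close>

lemma parallelogram_sign_choice:
  fixes q :: "('a \<Rightarrow> real) \<Rightarrow> real"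
  assumes par: "\<And>x y. q (\<lambda>v. x v + y v) + q (\<lambda>v. x v - y v) = 2 * q x + 2 * q y"
    and "finite \<A>" "disjoint \<A>"
  shows "\<exists>S. S \<subseteq> \<Union>\<A> \<and>
    (\<Sum>A\<in>\<A>. q (indicator A)) \<le> q (\<lambda>v. if v \<in> \<Union>\<A> then if v \<in> S then 1 else - 1 else 0)"
  using assms(2,3)
proof (induction \<A> rule: finite_induct)
  case empty
  \<comment> \<open>The law at two zero vectors reads \<open>2 * q 0 = 4 * q 0\<close>, so
    \<open>q\<close> vanishes at 0.\<close>
  show ?case using par[of "\<lambda>_. 0" "\<lambda>_. 0"] by simp
next
  case (insert A \<A>)
  have "disjoint \<A>" and dA: "A \<inter> \<Union>\<A> = {}"
    using insert.prems insert.hyps by (auto simp: disjoint_def)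
  then obtain S where S: "S \<subseteq> \<Union>\<A>"
    "(\<Sum>A\<in>\<A>. q (indicator A)) \<le> q (\<lambda>v. if v \<in> \<Union>\<A> then if v \<in> S then 1 else - 1 else 0)"
    using insert.IH by blast
  let ?x = "\<lambda>v. if v \<in> \<Union>\<A> then if v \<in> S then 1 else - 1 else 0 :: real"
  have "(\<lambda>v. ?x v + indicator A v) =
      (\<lambda>v. if v \<in> \<Union>(insert A \<A>) then if v \<in> S \<union> A then 1 else - 1 else 0)"
    "(\<lambda>v. ?x v - indicator A v) =
      (\<lambda>v. if v \<in> \<Union>(insert A \<A>) then if v \<in> S then 1 else - 1 else 0)"
    using S(1) dA by (auto simp: fun_eq_iff indicator_def)
  then have "q (\<lambda>v. if v \<in> \<Union>(insert A \<A>) then if v \<in> S \<union> A then 1 else - 1 else 0) +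
      q (\<lambda>v. if v \<in> \<Union>(insert A \<A>) then if v \<in> S then 1 else - 1 else 0)
      = 2 * q ?x + 2 * q (indicator A)"
    using par[of ?x "indicator A"] by simp
  moreover have "S \<union> A \<subseteq> \<Union>(insert A \<A>)" "S \<subseteq> \<Union>(insert A \<A>)" using S by auto
  moreover have "(\<Sum>B\<in>insert A \<A>. q (indicator B)) \<le> q (indicator A) + q ?x"
    using insert.hyps S(2) by simp
  ultimately have
    "(\<Sum>B\<in>insert A \<A>. q (indicator B)) \<le>
        q (\<lambda>v. if v \<in> \<Union>(insert A \<A>) then if v \<in> S \<union> A then 1 else - 1 else 0) \<or>
      (\<Sum>B\<in>insert A \<A>. q (indicator B)) \<le>
        q (\<lambda>v. if v \<in> \<Union>(insert A \<A>) then if v \<in> S then 1 else - 1 else 0)"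
    by linarith
  then show ?case
    using \<open>S \<union> A \<subseteq> \<Union>(insert A \<A>)\<close> \<open>S \<subseteq> \<Union>(insert A \<A>)\<close> by blast
qed

section \<open>Volumes and inner edges as sums over the edge set\<close>

lemma sum_degree_mult:
  assumes "finite V" "E \<subseteq> pairs V"
  shows "(\<Sum>v\<in>V. real (degree (V, E) v) * x v) = (\<Sum>e\<in>E. \<Sum>u\<in>e. x u)"
proof -
  have fE: "finite E" using assms finite_pairs finite_subset by blast
  have "(\<Sum>v\<in>V. real (degree (V, E) v) * x v) = (\<Sum>v\<in>V. \<Sum>e\<in>{e\<in>E. v \<in> e}. x v)"
    by (simp add: degree_def)
  also have "\<dots> = (\<Sum>e\<in>E. \<Sum>v\<in>{v\<in>V. v \<in> e}. x v)"
    by (rule sum.swap_restrict) (use assms fE in auto)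
  also have "\<dots> = (\<Sum>e\<in>E. \<Sum>u\<in>e. x u)"
    using assms(2) by (intro sum.cong) (auto simp: pairs_def)
  finally show ?thesis .
qed

lemma vol_eq:
  assumes "finite V" "E \<subseteq> pairs V" "S \<subseteq> V"
  shows "real (vol (V, E) S) = (\<Sum>e\<in>E. \<Sum>u\<in>e. indicator S u)"
proof -
  have "real (vol (V, E) S) = (\<Sum>v\<in>V. real (degree (V, E) v) * indicator S v)"
    unfolding vol_def of_nat_sum using assms
    by (intro sum.mono_neutral_cong_left) (auto simp: indicator_def)
  then show ?thesis using sum_degree_mult[OF assms(1,2), of "indicator S"] by simp
qed

lemma edges_within_eq:
  assumes "finite V" "E \<subseteq> pairs V"
  shows "real (edges_within (V, E) S) = (\<Sum>e\<in>E. \<Prod>u\<in>e. indicator S u)"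
proof -
  have fE: "finite E" using assms finite_pairs finite_subset by blast
  have "real (edges_within (V, E) S) = (\<Sum>e\<in>E. if e \<subseteq> S then 1 else 0)"
    using fE by (simp add: edges_within_def sum.If_cases Int_def)
  also have "\<dots> = (\<Sum>e\<in>E. \<Prod>u\<in>e. indicator S u)"
  proof (intro sum.cong refl)
    fix e assume "e \<in> E"
    then have "finite e" using assms by (auto simp: pairs_def intro: finite_subset)
    then show "(if e \<subseteq> S then 1 else 0) = (\<Prod>u\<in>e. indicator S u :: real)"
      by (cases "e \<subseteq> S") (auto simp: subset_iff indicator_def intro!: prod.neutral prod_zero)
  qed
  finally show ?thesis .
qed

lemma finite_partitions: "finite V \<Longrightarrow> finite {\<A>. partition_on V \<A>}"
  by (rule finite_subset[of _ "Pow (Pow V)"]) (auto simp: partition_on_def)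

text \<open>The score is a sum of values of one quadratic form at the indicators of the parts, so
  the sign choice reduces all partitions to single subsets \<open>S\<close>; centring then
  eliminates the degrees from the bound.\<close>

lemma modularity_le:
  assumes "finite V" "E \<subseteq> pairs V"
    and bound: "\<And>S. S \<subseteq> V \<Longrightarrow> (\<Sum>e\<in>E. \<Prod>u\<in>e. centred_sign V S u) \<le> B"
  shows "modularity (V, E) \<le> B / real (card E)"
proof -
  have fE: "finite E" using assms finite_pairs finite_subset by blast
  define N where "N = real (card E)"
  have N: "N > 0" if "E \<noteq> {}" using that fE by (simp add: N_def card_gt_0_iff)
  \<comment> \<open>Since the total volume is \<open>2 * N\<close>, the score of a part is
    \<open>q\<close> at its indicator divided by \<open>N\<close>. Both terms of \<open>q\<close>
    are quadratic in \<open>x\<close>, hence the parallelogram law.\<close>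
  define q where "q x = (\<Sum>e\<in>E. \<Prod>u\<in>e. x u) - (\<Sum>e\<in>E. \<Sum>u\<in>e. x u)\<^sup>2 / (4 * N)"
    for x :: "'a \<Rightarrow> real"
  have pair: "\<exists>a b. e = {a, b} \<and> a \<noteq> b" if "e \<in> E" for e
    using that assms(2) by (auto simp: pairs_def card_2_iff)
  have par: "q (\<lambda>v. x v + y v) + q (\<lambda>v. x v - y v) = 2 * q x + 2 * q y" for x y
  proof -
    have "(\<Sum>e\<in>E. \<Prod>u\<in>e. x u + y u) + (\<Sum>e\<in>E. \<Prod>u\<in>e. x u - y u)
        = (\<Sum>e\<in>E. 2 * (\<Prod>u\<in>e. x u) + 2 * (\<Prod>u\<in>e. y u))"
      unfolding sum.distrib[symmetric]
      by (intro sum.cong refl) (auto dest!: pair simp: algebra_simps)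
    also have "\<dots> = 2 * (\<Sum>e\<in>E. \<Prod>u\<in>e. x u) + 2 * (\<Sum>e\<in>E. \<Prod>u\<in>e. y u)"
      by (simp add: sum.distrib sum_distrib_left)
    finally show ?thesis
      unfolding q_def sum.distrib sum_subtractf
      by (simp add: sum.distrib sum_distrib_left[symmetric] power2_eq_square
          add_divide_distrib diff_divide_distrib algebra_simps)
  qed
  have volV: "real (vol (V, E) V) = 2 * N"
  proof -
    have "(\<Sum>e\<in>E. \<Sum>u\<in>e. indicator V u :: real) = (\<Sum>e\<in>E. 2)"
    proof (intro sum.cong refl)
      fix e assume "e \<in> E"
      then have "e \<subseteq> V" "card e = 2" using assms(2) by (auto simp: pairs_def)
      then show "(\<Sum>u\<in>e. indicator V u :: real) = 2"
        by (subst sum.cong[OF refl, of _ _ "\<lambda>_. 1"]) auto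
    qed
    then show ?thesis using vol_eq[OF assms(1,2), of V] by (simp add: N_def)
  qed
  have score: "modularity_score (V, E) \<A> \<le> B / N" if part: "partition_on V \<A>" for \<A>
  proof (cases "E = {}")
    case True
    \<comment> \<open>Without edges all terms of the score vanish, and \<open>B / N\<close> is 0 as
      a division by 0.\<close>
    then show ?thesis
      by (simp add: modularity_score_def N_def edges_within_def vol_def degree_def)
  next
    case False
    note N = N[OF False]
    have AV: "\<Union>\<A> = V" and dis: "disjoint \<A>" and fA: "finite \<A>"
      using part finite_elements[OF assms(1) part] by (auto simp: partition_on_def)
    have "modularity_score (V, E) \<A> = (\<Sum>A\<in>\<A>. q (indicator A) / N)"
      unfolding modularity_score_def
    proof (intro sum.cong refl)
      fix A assume "A \<in> \<A>"
      then have "A \<subseteq> V" using AV by auto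
      then show "real (edges_within (V, E) A) / real (card (snd (V, E)))
          - (real (vol (V, E) A) / real (vol (V, E) (fst (V, E))))\<^sup>2 = q (indicator A) / N"
        using N volV edges_within_eq[OF assms(1,2), of A] vol_eq[OF assms(1,2), of A]
        by (simp add: q_def N_def[symmetric] power_divide power2_eq_square field_simps)
    qed
    then have eq: "modularity_score (V, E) \<A> = (\<Sum>A\<in>\<A>. q (indicator A)) / N"
      by (simp add: sum_divide_distrib)
    obtain S where S: "S \<subseteq> V"
      "(\<Sum>A\<in>\<A>. q (indicator A)) \<le> q (\<lambda>v. if v \<in> V then if v \<in> S then 1 else - 1 else 0)"
      using parallelogram_sign_choice[of q, OF par fA dis] AV by auto
    define x where "x v = (if v \<in> V then if v \<in> S then 1 else - 1 else 0 :: real)" for v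
    \<comment> \<open>The inequality for \<open>t\<close> below holds for every real shift; the mean
      is taken so that the shifted vector sums to 0.\<close>
    define a where "a = (\<Sum>u\<in>V. if u \<in> S then 1 else - 1) / real (card V)"
    have x: "centred_sign V S v = x v - a" if "v \<in> V" for v
      using that by (simp add: centred_sign_def x_def a_def)
    define t where "t = (\<Sum>e\<in>E. \<Sum>u\<in>e. x u)"
    \<comment> \<open>Replaces the volume term, which depends on the graph, by a shift of \<open>x\<close> to mean zero.\<close>
    have "t\<^sup>2 / (4 * N) \<ge> a * t - a\<^sup>2 * N"
    proof -
      have "0 \<le> (t - 2 * a * N)\<^sup>2" by simp
      then have "4 * N * (a * t - a\<^sup>2 * N) \<le> t\<^sup>2"
        by (simp add: power2_eq_square algebra_simps)
      then show ?thesis using N by (simp add: field_simps)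
    qed
    then have "q x \<le> (\<Sum>e\<in>E. \<Prod>u\<in>e. x u) - a * t + a\<^sup>2 * N"
      by (simp add: q_def t_def)
    \<comment> \<open>Distributing \<open>a^2 * N\<close> as one \<open>a^2\<close> per edge turns
      the summand of an edge \<open>{b, c}\<close> into
      \<open>(x b - a) * (x c - a)\<close>.\<close>
    also have "\<dots> = (\<Sum>e\<in>E. (\<Prod>u\<in>e. x u) - a * (\<Sum>u\<in>e. x u) + a\<^sup>2)"
      by (simp add: t_def N_def sum.distrib sum_subtractf sum_distrib_left[symmetric] mult.commute)
    also have "\<dots> = (\<Sum>e\<in>E. \<Prod>u\<in>e. centred_sign V S u)"
    proof (intro sum.cong refl)
      fix e assume e: "e \<in> E"
      then obtain b c where bc: "e = {b, c}" "b \<noteq> c" using pair by blast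
      then have "b \<in> V" "c \<in> V" using e assms(2) by (auto simp: pairs_def)
      then show "(\<Prod>u\<in>e. x u) - a * (\<Sum>u\<in>e. x u) + a\<^sup>2 = (\<Prod>u\<in>e. centred_sign V S u)"
        using bc by (simp add: x power2_eq_square algebra_simps)
    qed
    also have "\<dots> \<le> B" by (rule bound) (rule S)
    finally have "q x \<le> B" .
    then have "(\<Sum>A\<in>\<A>. q (indicator A)) \<le> B" using S(2) unfolding x_def by linarith
    then show ?thesis unfolding eq using N by (simp add: divide_right_mono)
  qed
  have "{modularity_score (V, E) \<A> | \<A>. partition_on V \<A>} =
      modularity_score (V, E) ` {\<A>. partition_on V \<A>}" by auto
  moreover have "\<exists>\<A>. partition_on V \<A>" using partition_on_singletons by auto
  ultimately show ?thesis
    unfolding modularity_def fst_conv N_def[symmetric] using finite_partitions[OF assms(1)] score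
    by (subst Max_le_iff) auto
qed

section \<open>From edges to contributions of single attributes\<close>

text \<open>A pair lying in \<open>k\<close> of the sets \<open>H w\<close> counts once on the left
  if \<open>k > 0\<close>, but \<open>k\<close> times in the sum over \<open>w\<close>. The
  discrepancy is bounded by \<open>k choose 2\<close> because this counts pairs of attributes and so
  has an easily computed expectation.\<close>

lemma sum_edges_approx:
  fixes H :: "'b \<Rightarrow> 'a set"
  assumes "finite V" "finite W" "\<And>w. w \<in> W \<Longrightarrow> H w \<subseteq> V"
    and y: "\<And>u. u \<in> V \<Longrightarrow> \<bar>y u\<bar> \<le> c"
  shows "\<bar>(\<Sum>e\<in>{e\<in>pairs V. \<exists>w\<in>W. e \<subseteq> H w}. \<Prod>u\<in>e. y u) - (\<Sum>w\<in>W. pair_sum y (H w))\<bar>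
    \<le> c\<^sup>2 * (\<Sum>e\<in>pairs V. real (card {w\<in>W. e \<subseteq> H w} choose 2))"
proof -
  define N where "N e = card {w\<in>W. e \<subseteq> H w}" for e
  define \<pi> where "\<pi> e = (\<Prod>u\<in>e. y u)" for e
  have fP: "finite (pairs V)" using assms by auto
  have N0: "(\<exists>w\<in>W. e \<subseteq> H w) \<longleftrightarrow> N e \<noteq> 0" for e
    using assms(2) by (auto simp: N_def)
  have 1: "(\<Sum>e\<in>{e\<in>pairs V. \<exists>w\<in>W. e \<subseteq> H w}. \<pi> e) = (\<Sum>e\<in>pairs V. if N e \<noteq> 0 then \<pi> e else 0)"
    unfolding N0 using fP by (simp add: sum.If_cases Int_def)
  have "(\<Sum>w\<in>W. pair_sum y (H w)) = (\<Sum>w\<in>W. \<Sum>e\<in>{e\<in>pairs V. e \<subseteq> H w}. \<pi> e)"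
    unfolding pair_sum_def \<pi>_def using assms(3)
    by (intro sum.cong) (auto simp: pairs_def)
  also have "\<dots> = (\<Sum>e\<in>pairs V. \<Sum>w\<in>{w\<in>W. e \<subseteq> H w}. \<pi> e)"
    by (rule sum.swap_restrict) (use assms fP in auto)
  also have "\<dots> = (\<Sum>e\<in>pairs V. real (N e) * \<pi> e)" by (simp add: N_def)
  finally have 2: "(\<Sum>w\<in>W. pair_sum y (H w)) = (\<Sum>e\<in>pairs V. real (N e) * \<pi> e)" .
  have \<pi>: "\<bar>\<pi> e\<bar> \<le> c\<^sup>2" if "e \<in> pairs V" for e
    unfolding \<pi>_def using that y by (rule abs_prod_pair_le)
  \<comment> \<open>For \<open>k = j + 1\<close> the discrepancy is \<open>j\<close>, and Pascal's
    rule exhibits \<open>j\<close> as a summand of \<open>k choose 2\<close>.\<close>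
  have cnt: "\<bar>(if k \<noteq> 0 then 1 else 0) - real k\<bar> \<le> real (k choose 2)" for k :: nat
  proof (cases k)
    case (Suc j)
    have "k choose 2 = j + (j choose 2)" unfolding Suc by (simp add: numeral_2_eq_2)
    then show ?thesis using Suc by simp
  qed simp
  have "\<bar>(\<Sum>e\<in>pairs V. (if N e \<noteq> 0 then \<pi> e else 0) - real (N e) * \<pi> e)\<bar>
      \<le> (\<Sum>e\<in>pairs V. c\<^sup>2 * real (N e choose 2))"
  proof (intro order.trans[OF sum_abs] sum_mono)
    fix e assume e: "e \<in> pairs V"
    have "(if N e \<noteq> 0 then \<pi> e else 0) - real (N e) * \<pi> e
        = ((if N e \<noteq> 0 then 1 else 0) - real (N e)) * \<pi> e"
      by (simp add: left_diff_distrib)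
    then have "\<bar>(if N e \<noteq> 0 then \<pi> e else 0) - real (N e) * \<pi> e\<bar>
        = \<bar>(if N e \<noteq> 0 then 1 else 0) - real (N e)\<bar> * \<bar>\<pi> e\<bar>"
      by (simp only: abs_mult)
    also have "\<dots> \<le> real (N e choose 2) * c\<^sup>2"
      using cnt \<pi>[OF e] by (intro mult_mono) auto
    finally show "\<bar>(if N e \<noteq> 0 then \<pi> e else 0) - real (N e) * \<pi> e\<bar> \<le> c\<^sup>2 * real (N e choose 2)"
      by (simp add: mult.commute)
  qed
  then show ?thesis
    using 1 2 by (simp add: sum_subtractf sum_distrib_left \<pi>_def N_def)
qed

text \<open>Changes the viewpoint from the attributes of a vertex to the holders of an attribute:
  the graph is a union of cliques, one for each attribute, on vertex sets that are
  independent.\<close>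

lemma intersection_graph_eq:
  "intersection_graph n (attributes m X) =
    ({1..n}, {e\<in>pairs {1..n}. \<exists>w\<in>{1..m}. e \<subseteq> {v\<in>{1..n}. X (v, w)}})"
proof -
  have "(\<exists>u v. e = {u, v} \<and> u \<in> {1..n} \<and> v \<in> {1..n} \<and> u \<noteq> v \<and>
      attributes m X u \<inter> attributes m X v \<noteq> {}) \<longleftrightarrow>
    (e \<in> pairs {1..n} \<and> (\<exists>w\<in>{1..m}. e \<subseteq> {v\<in>{1..n}. X (v, w)}))" for e
  proof
    assume "e \<in> pairs {1..n} \<and> (\<exists>w\<in>{1..m}. e \<subseteq> {v\<in>{1..n}. X (v, w)})"
    then obtain u v w where "e = {u, v}" "u \<noteq> v" "e \<subseteq> {1..n}" "w \<in> {1..m}"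
      "e \<subseteq> {v\<in>{1..n}. X (v, w)}"
      unfolding pairs_def card_2_iff by blast
    then have "u \<in> {1..n}" "v \<in> {1..n}" "w \<in> attributes m X u \<inter> attributes m X v"
      by (auto simp: attributes_def)
    then show "\<exists>u v. e = {u, v} \<and> u \<in> {1..n} \<and> v \<in> {1..n} \<and> u \<noteq> v \<and>
        attributes m X u \<inter> attributes m X v \<noteq> {}"
      using \<open>e = {u, v}\<close> \<open>u \<noteq> v\<close> by blast
  qed (auto simp: pairs_def attributes_def)
  then show ?thesis unfolding intersection_graph_def by blast
qed

section \<open>Random subsets and exponential moments\<close>

text \<open>The law of the set of holders of one attribute.\<close>

definition random_subset :: "'a set \<Rightarrow> real \<Rightarrow> 'a set pmf" where
  "random_subset V p = map_pmf (\<lambda>X. {v\<in>V. X v}) (Pi_pmf V False (\<lambda>_. bernoulli_pmf p))"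

text \<open>Finite support makes every real function integrable, which settles the integrability
  conditions below.\<close>

lemma finite_set_Pi_bernoulli:
  "finite I \<Longrightarrow> finite (set_pmf (Pi_pmf I False (\<lambda>_. bernoulli_pmf p)))"
  by (subst set_Pi_pmf) (auto intro!: finite_PiE_dflt)

lemma set_random_subset: "set_pmf (random_subset V p) \<subseteq> Pow V"
  by (auto simp: random_subset_def)

lemma finite_set_random_subset: "finite V \<Longrightarrow> finite (set_pmf (random_subset V p))"
  using set_random_subset[of V p] by (rule finite_subset) simp

lemma prob_all_true:
  assumes "finite I" "T \<subseteq> I" "0 \<le> p" "p \<le> 1"
  shows "measure_pmf.prob (Pi_pmf I False (\<lambda>_. bernoulli_pmf p)) {X. \<forall>x\<in>T. X x} = p ^ card T"
proof -
  have "{X. \<forall>x\<in>T. X x} = Pi I (\<lambda>x. if x \<in> T then {True} else UNIV)"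
    using assms(2) by (force simp: Pi_def)
  then have "measure_pmf.prob (Pi_pmf I False (\<lambda>_. bernoulli_pmf p)) {X. \<forall>x\<in>T. X x}
      = (\<Prod>x\<in>I. measure_pmf.prob (bernoulli_pmf p) (if x \<in> T then {True} else UNIV))"
    using measure_Pi_pmf_Pi[OF assms(1), of False "\<lambda>_. bernoulli_pmf p"] by simp
  also have "\<dots> = (\<Prod>x\<in>I. if x \<in> T then p else 1)"
    using assms(3,4) by (intro prod.cong) (auto simp: measure_pmf_single)
  also have "\<dots> = p ^ card T"
    using assms(1,2) by (simp add: prod.If_cases Int_absorb1)
  finally show ?thesis .
qed

text \<open>The indexed family \<open>T\<close> serves two purposes: subsets of the vertex set for a
  single attribute, and products of a vertex pair with an attribute pair for multiply generated
  edges.\<close>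

lemma expectation_sum_all_true:
  fixes c :: "'b \<Rightarrow> real"
  assumes "finite I" "0 \<le> p" "p \<le> 1" "\<And>i. i \<in> F \<Longrightarrow> T i \<subseteq> I"
  shows "measure_pmf.expectation (Pi_pmf I False (\<lambda>_. bernoulli_pmf p))
      (\<lambda>X. \<Sum>i\<in>F. c i * of_bool (\<forall>x\<in>T i. X x)) = (\<Sum>i\<in>F. c i * p ^ card (T i))"
proof -
  let ?P = "Pi_pmf I False (\<lambda>_. bernoulli_pmf p)"
  note int = integrable_measure_pmf_finite[OF finite_set_Pi_bernoulli[OF assms(1), of p]]
  have "measure_pmf.expectation ?P (\<lambda>X. \<Sum>i\<in>F. c i * of_bool (\<forall>x\<in>T i. X x))
      = (\<Sum>i\<in>F. c i * measure_pmf.expectation ?P (\<lambda>X. of_bool (\<forall>x\<in>T i. X x)))"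
    by (subst Bochner_Integration.integral_sum) (auto intro: int)
  also have "\<dots> = (\<Sum>i\<in>F. c i * p ^ card (T i))"
  proof (intro sum.cong refl)
    fix i assume "i \<in> F"
    have "(\<lambda>X. of_bool (\<forall>x\<in>T i. X x)) = (indicator {X. \<forall>x\<in>T i. X x} :: _ \<Rightarrow> real)"
      by (auto simp: fun_eq_iff)
    then show "c i * measure_pmf.expectation ?P (\<lambda>X. of_bool (\<forall>x\<in>T i. X x)) = c i * p ^ card (T i)"
      using prob_all_true[OF assms(1) assms(4)[OF \<open>i \<in> F\<close>] assms(2,3)] by simp
  qed
  finally show ?thesis .
qed

lemma expectation_sum_superset:
  fixes c :: "'a set \<Rightarrow> real"
  assumes "finite V" "0 \<le> p" "p \<le> 1" "F \<subseteq> Pow V"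
  shows "measure_pmf.expectation (random_subset V p) (\<lambda>A. \<Sum>T\<in>F. c T * of_bool (T \<subseteq> A))
    = (\<Sum>T\<in>F. c T * p ^ card T)"
proof -
  have "(\<lambda>X. \<Sum>T\<in>F. c T * of_bool (T \<subseteq> {v\<in>V. X v})) = (\<lambda>X. \<Sum>T\<in>F. c T * of_bool (\<forall>x\<in>T. X x))"
    using assms(4) by (intro ext sum.cong) auto
  then show ?thesis
    unfolding random_subset_def using expectation_sum_all_true[of V p F "\<lambda>T. T" c] assms
    by auto
qed

lemma expectation_cong_random_subset:
  fixes f g :: "'a set \<Rightarrow> real"
  assumes "\<And>A. A \<subseteq> V \<Longrightarrow> f A = g A"
  shows "measure_pmf.expectation (random_subset V p) f = measure_pmf.expectation (random_subset V p) g"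
  using set_random_subset[of V p] assms by (intro integral_cong_AE AE_pmfI) auto

lemma expectation_mono_random_subset:
  fixes f g :: "'a set \<Rightarrow> real"
  assumes "finite V" "\<And>A. A \<subseteq> V \<Longrightarrow> f A \<le> g A"
  shows "measure_pmf.expectation (random_subset V p) f \<le> measure_pmf.expectation (random_subset V p) g"
  using set_random_subset[of V p] assms
  by (intro integral_mono_AE integrable_measure_pmf_finite finite_set_random_subset AE_pmfI) auto

text \<open>Binomial moments by linearity: \<open>card A choose k\<close> counts the
  \<open>k\<close>-subsets of \<open>V\<close> that survive in \<open>A\<close>, each with
  probability \<open>p ^ k\<close>.\<close>

lemma expectation_card_choose:
  assumes "finite V" "0 \<le> p" "p \<le> 1"
  shows "measure_pmf.expectation (random_subset V p) (\<lambda>A. real (card A choose k))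
    = real (card V choose k) * p ^ k"
proof -
  let ?F = "{T. T \<subseteq> V \<and> card T = k}"
  have "measure_pmf.expectation (random_subset V p) (\<lambda>A. real (card A choose k))
    = measure_pmf.expectation (random_subset V p) (\<lambda>A. \<Sum>T\<in>?F. 1 * of_bool (T \<subseteq> A))"
  proof (rule expectation_cong_random_subset)
    fix A assume A: "A \<subseteq> V"
    then have "{T\<in>?F. T \<subseteq> A} = {T. T \<subseteq> A \<and> card T = k}" by auto
    moreover have "(\<Sum>T\<in>?F. 1 * of_bool (T \<subseteq> A)) = real (card {T\<in>?F. T \<subseteq> A})"
      using assms(1) by (simp add: of_bool_def sum.If_cases Int_def)
    ultimately show "real (card A choose k) = (\<Sum>T\<in>?F. 1 * of_bool (T \<subseteq> A))"
      using n_subsets[of A k] finite_subset[OF A assms(1)] by simp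
  qed
  also have "\<dots> = (\<Sum>T\<in>?F. 1 * p ^ card T)"
    by (rule expectation_sum_superset) (use assms in auto)
  also have "\<dots> = real (card V choose k) * p ^ k"
    using n_subsets[OF assms(1), of k] by simp
  finally show ?thesis .
qed

lemma expectation_pair_sum:
  assumes "finite V" "0 \<le> p" "p \<le> 1"
  shows "measure_pmf.expectation (random_subset V p) (pair_sum y) = p\<^sup>2 * pair_sum y V"
proof -
  have "measure_pmf.expectation (random_subset V p) (pair_sum y)
    = measure_pmf.expectation (random_subset V p)
        (\<lambda>A. \<Sum>e\<in>pairs V. (\<Prod>u\<in>e. y u) * of_bool (e \<subseteq> A))"
  proof (rule expectation_cong_random_subset)
    fix A assume A: "A \<subseteq> V"
    then show "pair_sum y A = (\<Sum>e\<in>pairs V. (\<Prod>u\<in>e. y u) * of_bool (e \<subseteq> A))"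
      unfolding pair_sum_def using assms(1)
      by (intro sum.mono_neutral_cong_left) (auto simp: pairs_def)
  qed
  also have "\<dots> = (\<Sum>e\<in>pairs V. (\<Prod>u\<in>e. y u) * p ^ card e)"
    by (rule expectation_sum_superset) (use assms in \<open>auto simp: pairs_def\<close>)
  also have "\<dots> = (\<Sum>e\<in>pairs V. (\<Prod>u\<in>e. y u) * p\<^sup>2)"
    by (intro sum.cong) (auto simp: pairs_def)
  also have "\<dots> = p\<^sup>2 * pair_sum y V"
    by (simp add: pair_sum_def sum_distrib_right[symmetric] mult.commute)
  finally show ?thesis .
qed

section \<open>Independence of the attribute columns\<close>

text \<open>Currying is injective, so point masses can be compared. The double product regroups by
  columns; the care lies in the default values, which are required off \<open>V \<times> W\<close>
  on one side, and off \<open>W\<close> and inside each column off \<open>V\<close> on the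
  other.\<close>

lemma Pi_pmf_columns:
  assumes "finite V" "finite W"
  shows "map_pmf (\<lambda>X w v. X (v, w)) (Pi_pmf (V \<times> W) d (\<lambda>_. q))
    = Pi_pmf W (\<lambda>_. d) (\<lambda>_. Pi_pmf V d (\<lambda>_. q))"
proof (rule pmf_eqI)
  fix Y :: "'b \<Rightarrow> 'a \<Rightarrow> 'c"
  have inj: "inj (\<lambda>X w v. X (v, w) :: 'c)" by (auto simp: inj_def fun_eq_iff)
  have "pmf (map_pmf (\<lambda>X w v. X (v, w)) (Pi_pmf (V \<times> W) d (\<lambda>_. q))) Y
      = pmf (Pi_pmf (V \<times> W) d (\<lambda>_. q)) (\<lambda>(v, w). Y w v)"
    using pmf_map_inj'[OF inj, of "Pi_pmf (V \<times> W) d (\<lambda>_. q)" "\<lambda>(v, w). Y w v"] by simp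
  also have "\<dots> = (if \<forall>v w. (v, w) \<notin> V \<times> W \<longrightarrow> Y w v = d then \<Prod>w\<in>W. \<Prod>v\<in>V. pmf q (Y w v) else 0)"
    using assms prod.swap[of "\<lambda>w v. pmf q (Y w v)" V W]
      prod.cartesian_product[of "\<lambda>v w. pmf q (Y w v)" W V]
    by (subst pmf_Pi) (auto simp: case_prod_unfold)
  also have "\<dots> = (if \<forall>w. w \<notin> W \<longrightarrow> Y w = (\<lambda>_. d) then
      \<Prod>w\<in>W. if \<forall>v. v \<notin> V \<longrightarrow> Y w v = d then \<Prod>v\<in>V. pmf q (Y w v) else 0 else 0)"
  proof (cases "\<forall>v w. (v, w) \<notin> V \<times> W \<longrightarrow> Y w v = d")
    case True
    then show ?thesis by (auto simp: fun_eq_iff)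
  next
    case False
    then consider (1) w v where "w \<notin> W" "Y w v \<noteq> d" | (2) w v where "w \<in> W" "v \<notin> V" "Y w v \<noteq> d"
      by auto
    then show ?thesis
    proof cases
      case 1
      then show ?thesis using False by (auto simp: fun_eq_iff)
    next
      \<comment> \<open>A wrong default inside a column of \<open>W\<close> annihilates the mass of
        that column and with it the whole product.\<close>
      case 2
      then have "(\<Prod>w\<in>W. if \<forall>v. v \<notin> V \<longrightarrow> Y w v = d then \<Prod>v\<in>V. pmf q (Y w v) else 0) = 0"
        using assms(2) by (intro prod_zero) auto
      then show ?thesis unfolding if_not_P[OF False] by simp
    qed
  qed
  also have "\<dots> = pmf (Pi_pmf W (\<lambda>_. d) (\<lambda>_. Pi_pmf V d (\<lambda>_. q))) Y"
    using assms by (subst pmf_Pi) (auto simp: pmf_Pi)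
  finally show "pmf (map_pmf (\<lambda>X w v. X (v, w)) (Pi_pmf (V \<times> W) d (\<lambda>_. q))) Y
      = pmf (Pi_pmf W (\<lambda>_. d) (\<lambda>_. Pi_pmf V d (\<lambda>_. q))) Y" .
qed

lemma expectation_prod_columns:
  fixes f :: "'a set \<Rightarrow> real"
  assumes "finite V" "finite W" "\<And>A. f A \<ge> 0"
  shows "measure_pmf.expectation (Pi_pmf (V \<times> W) False (\<lambda>_. bernoulli_pmf p))
      (\<lambda>X. \<Prod>w\<in>W. f {v\<in>V. X (v, w)}) = measure_pmf.expectation (random_subset V p) f ^ card W"
proof -
  let ?P = "Pi_pmf (V \<times> W) False (\<lambda>_. bernoulli_pmf p)"
  have "measure_pmf.expectation ?P (\<lambda>X. \<Prod>w\<in>W. f {v\<in>V. X (v, w)})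
    = measure_pmf.expectation (map_pmf (\<lambda>X w v. X (v, w)) ?P) (\<lambda>Y. \<Prod>w\<in>W. f {v\<in>V. Y w v})"
    by simp
  also have "\<dots> = (\<Prod>w\<in>W. measure_pmf.expectation (Pi_pmf V False (\<lambda>_. bernoulli_pmf p))
      (\<lambda>Z. f {v\<in>V. Z v}))"
    unfolding Pi_pmf_columns[OF assms(1,2)] using assms
    by (intro expectation_prod_Pi_pmf) (auto intro!: integrable_measure_pmf_finite finite_set_Pi_bernoulli)
  finally show ?thesis by (simp add: random_subset_def)
qed

lemma expectation_sum_columns:
  fixes f :: "'a set \<Rightarrow> real"
  assumes "finite V" "finite W"
  shows "measure_pmf.expectation (Pi_pmf (V \<times> W) False (\<lambda>_. bernoulli_pmf p))
      (\<lambda>X. \<Sum>w\<in>W. f {v\<in>V. X (v, w)}) = real (card W) * measure_pmf.expectation (random_subset V p) f"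
proof -
  let ?P = "Pi_pmf (V \<times> W) False (\<lambda>_. bernoulli_pmf p)"
  have "measure_pmf.expectation ?P (\<lambda>X. f {v\<in>V. X (v, w)})
      = measure_pmf.expectation (random_subset V p) f" if "w \<in> W" for w
  proof -
    have "measure_pmf.expectation ?P (\<lambda>X. f {v\<in>V. X (v, w)})
      = measure_pmf.expectation (map_pmf (\<lambda>Y. Y w) (map_pmf (\<lambda>X w v. X (v, w)) ?P)) (\<lambda>Z. f {v\<in>V. Z v})"
      by simp
    also have "\<dots> = measure_pmf.expectation (random_subset V p) f"
      unfolding Pi_pmf_columns[OF assms] Pi_pmf_component[OF assms(2)]
      using that by (simp add: random_subset_def)
    finally show ?thesis .
  qed
  then show ?thesis
    using assms by (subst Bochner_Integration.integral_sum)
      (auto intro!: integrable_measure_pmf_finite finite_set_Pi_bernoulli)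
qed

section \<open>Exponential moments and the Chernoff bound\<close>

text \<open>Taylor's formula with Lagrange remainder. The linear term stays exact, so a nonpositive
  mean is passed on to the exponent with its sign.\<close>

lemma exp_le_quadratic: "exp x \<le> 1 + x + x\<^sup>2 * exp \<bar>x\<bar>" for x :: real
proof -
  obtain t where t: "\<bar>t\<bar> \<le> \<bar>x\<bar>" "exp x = (\<Sum>k<2. x ^ k / fact k) + exp t / fact 2 * x ^ 2"
    using Maclaurin_exp_le[of x 2] by blast
  have "t \<le> \<bar>x\<bar>" using t(1) by linarith
  then have "exp t \<le> exp \<bar>x\<bar>" by simp
  then have "exp t / 2 \<le> exp \<bar>x\<bar>" using exp_gt_zero[of t] by linarith
  then have "exp t / 2 * x\<^sup>2 \<le> exp \<bar>x\<bar> * x\<^sup>2" by (intro mult_right_mono) auto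
  moreover have "(\<Sum>k<2. x ^ k / fact k) = 1 + x" by (simp add: lessThan_nat_numeral lessThan_Suc)
  ultimately show ?thesis using t(2) by (simp add: mult.commute)
qed

lemma binomial_le_power: "real (n choose k) \<le> real n ^ k"
proof (cases "k \<le> n")
  case True
  then show ?thesis using binomial_le_pow[OF True] by (metis of_nat_le_iff of_nat_power)
qed (simp add: binomial_eq_0)

text \<open>Since \<open>h\<close> vanishes on sets with fewer than two elements, the quadratic
  remainder is at most a constant times \<open>card A choose 2\<close>. Its expectation then carries
  the small factor \<open>(card V * p)^2\<close>. The condition \<open>l \<le> 1\<close> keeps the
  exponent in the remainder below \<open>B\<close>.\<close>

lemma expectation_exp_le:
  fixes h :: "'a set \<Rightarrow> real"
  assumes V: "finite V" "0 \<le> p" "p \<le> 1"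
    and bounded: "\<And>A. A \<subseteq> V \<Longrightarrow> \<bar>h A\<bar> \<le> B"
    and zero: "\<And>A. A \<subseteq> V \<Longrightarrow> card A < 2 \<Longrightarrow> h A = 0"
    and l: "0 \<le> l" "l \<le> 1"
  shows "measure_pmf.expectation (random_subset V p) (\<lambda>A. exp (l * h A))
    \<le> exp (l * measure_pmf.expectation (random_subset V p) h
        + l\<^sup>2 * (B\<^sup>2 * exp B) * (real (card V) * p)\<^sup>2)"
proof -
  let ?E = "measure_pmf.expectation (random_subset V p)"
  define K where "K = l\<^sup>2 * (B\<^sup>2 * exp B)"
  have int: "integrable (random_subset V p) f" for f :: "_ \<Rightarrow> real"
    by (intro integrable_measure_pmf_finite finite_set_random_subset V)
  have K: "K \<ge> 0" by (simp add: K_def)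
  have "?E (\<lambda>A. exp (l * h A)) \<le> ?E (\<lambda>A. 1 + l * h A + K * real (card A choose 2))"
  proof (rule expectation_mono_random_subset[OF V(1)])
    fix A assume A: "A \<subseteq> V"
    show "exp (l * h A) \<le> 1 + l * h A + K * real (card A choose 2)"
    proof (cases "card A < 2")
      case True
      then show ?thesis using zero[OF A] K by simp
    next
      case False
      then have "1 \<le> card A choose 2" by (simp add: Suc_leI zero_less_binomial)
      then have c: "1 \<le> real (card A choose 2)" by linarith
      have "\<bar>l * h A\<bar> \<le> B"
        using bounded[OF A] l mult_mono[of l 1 "\<bar>h A\<bar>" B] by (simp add: abs_mult)
      moreover have "(l * h A)\<^sup>2 \<le> l\<^sup>2 * B\<^sup>2"
        using bounded[OF A] power_mono[of "\<bar>h A\<bar>" B 2]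
        by (simp add: power_mult_distrib mult_left_mono)
      ultimately have "(l * h A)\<^sup>2 * exp \<bar>l * h A\<bar> \<le> (l\<^sup>2 * B\<^sup>2) * exp B"
        by (intro mult_mono) auto
      also have "\<dots> \<le> K * real (card A choose 2)"
        using mult_left_mono[OF c K] by (simp add: K_def mult.assoc)
      finally show ?thesis using exp_le_quadratic[of "l * h A"] by linarith
    qed
  qed
  also have "\<dots> = 1 + l * ?E h + K * ?E (\<lambda>A. real (card A choose 2))"
    by (subst Bochner_Integration.integral_add[OF int int])+ simp
  also have "\<dots> = 1 + l * ?E h + K * (real (card V choose 2) * p\<^sup>2)"
    by (simp add: expectation_card_choose[OF V])
  also have "\<dots> \<le> 1 + l * ?E h + K * (real (card V) * p)\<^sup>2"
    using K binomial_le_power[of "card V" 2]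
    by (auto simp: power_mult_distrib intro!: mult_left_mono mult_right_mono)
  also have "\<dots> \<le> exp (l * ?E h + K * (real (card V) * p)\<^sup>2)"
    using exp_ge_add_one_self[of "l * ?E h + K * (real (card V) * p)\<^sup>2"] by (simp add: add.assoc)
  finally show ?thesis by (simp add: K_def)
qed

text \<open>Chernoff's method: Markov's inequality for the exponential of the sum, whose expectation
  factors over the attributes. The parameter \<open>l\<close> stays free because the cut sums take
  \<open>1 / sqrt d\<close> and the edge count takes a constant.\<close>

lemma prob_sum_columns_ge:
  fixes h :: "'a set \<Rightarrow> real"
  assumes V: "finite V" "0 \<le> p" "p \<le> 1" and W: "finite W"
    and bounded: "\<And>A. A \<subseteq> V \<Longrightarrow> \<bar>h A\<bar> \<le> B"
    and zero: "\<And>A. A \<subseteq> V \<Longrightarrow> card A < 2 \<Longrightarrow> h A = 0"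
    and l: "0 < l" "l \<le> 1"
    and mean: "measure_pmf.expectation (random_subset V p) h \<le> \<mu>"
  shows "measure_pmf.prob (Pi_pmf (V \<times> W) False (\<lambda>_. bernoulli_pmf p))
      {X. t \<le> (\<Sum>w\<in>W. h {v\<in>V. X (v, w)})}
    \<le> exp (real (card W) * (l * \<mu> + l\<^sup>2 * (B\<^sup>2 * exp B) * (real (card V) * p)\<^sup>2) - l * t)"
proof -
  let ?P = "Pi_pmf (V \<times> W) False (\<lambda>_. bernoulli_pmf p)"
  let ?E = "measure_pmf.expectation (random_subset V p)"
  define c where "c = l\<^sup>2 * (B\<^sup>2 * exp B) * (real (card V) * p)\<^sup>2"
  have "{X. t \<le> (\<Sum>w\<in>W. h {v\<in>V. X (v, w)})}
      = {X. exp (l * t) \<le> (\<Prod>w\<in>W. exp (l * h {v\<in>V. X (v, w)}))}"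
    using l W by (simp add: exp_sum[symmetric] sum_distrib_left[symmetric])
  then have "measure_pmf.prob ?P {X. t \<le> (\<Sum>w\<in>W. h {v\<in>V. X (v, w)})}
      \<le> measure_pmf.expectation ?P (\<lambda>X. \<Prod>w\<in>W. exp (l * h {v\<in>V. X (v, w)})) / exp (l * t)"
    using integral_Markov_inequality_measure[of "measure_pmf ?P"
        "\<lambda>X. \<Prod>w\<in>W. exp (l * h {v\<in>V. X (v, w)})" UNIV "exp (l * t)"]
      V W by (simp add: prod_nonneg integrable_measure_pmf_finite finite_set_Pi_bernoulli)
  also have "\<dots> \<le> exp (real (card W) * (l * \<mu> + c)) / exp (l * t)"
  proof (rule divide_right_mono)
    have "measure_pmf.expectation ?P (\<lambda>X. \<Prod>w\<in>W. exp (l * h {v\<in>V. X (v, w)}))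
        = ?E (\<lambda>A. exp (l * h A)) ^ card W"
      by (rule expectation_prod_columns[OF V(1) W]) simp
    also have "\<dots> \<le> exp (l * \<mu> + c) ^ card W"
    proof (rule power_mono)
      have "?E (\<lambda>A. exp (l * h A)) \<le> exp (l * ?E h + c)"
        unfolding c_def using l by (intro expectation_exp_le V bounded zero) auto
      also have "\<dots> \<le> exp (l * \<mu> + c)" using mean l by simp
      finally show "?E (\<lambda>A. exp (l * h A)) \<le> exp (l * \<mu> + c)" .
    qed simp
    also have "\<dots> = exp (real (card W) * (l * \<mu> + c))" by (simp only: exp_of_nat_mult)
    finally show "measure_pmf.expectation ?P (\<lambda>X. \<Prod>w\<in>W. exp (l * h {v\<in>V. X (v, w)}))
        \<le> exp (real (card W) * (l * \<mu> + c))" .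
  qed simp
  finally show ?thesis by (simp only: c_def exp_diff)
qed

section \<open>Truncated attribute contributions\<close>

definition trunc_pair_sum :: "nat \<Rightarrow> ('a \<Rightarrow> real) \<Rightarrow> 'a set \<Rightarrow> real" where
  "trunc_pair_sum K y A = (if card A \<le> K then pair_sum y A else 0)"

lemma pair_sum_one: "finite A \<Longrightarrow> pair_sum (\<lambda>_. 1) A = real (card A choose 2)"
  by (simp add: pair_sum_def card_pairs)

text \<open>Counting pairs inside \<open>(K + 1)\<close>-subsets in two ways gives a factor
  \<open>(k - 2) choose (K - 1)\<close>, which is at least 1 when \<open>k > K\<close>. The tail is
  thereby dominated by a binomial moment of order \<open>K + 1\<close>.\<close>

lemma choose_2_mult_of_bool_le:
  assumes "K \<ge> 1"
  shows "real (k choose 2) * of_bool (K < k) \<le> (real K + 1)\<^sup>2 * real (k choose (K + 1))"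
proof (cases "K < k")
  case True
  have "(k choose 2) * 1 \<le> (k choose 2) * ((k - 2) choose (K + 1 - 2))"
    using True by (intro mult_left_mono) (simp_all add: Suc_leI zero_less_binomial)
  also have "\<dots> = (k choose (K + 1)) * ((K + 1) choose 2)"
    using True assms by (intro choose_mult[symmetric]) auto
  finally have "real (k choose 2) \<le> real (k choose (K + 1)) * real ((K + 1) choose 2)"
    by (metis mult_1_right of_nat_le_iff of_nat_mult)
  also have "\<dots> \<le> real (k choose (K + 1)) * (real (K + 1))\<^sup>2"
    by (intro mult_left_mono binomial_le_power) auto
  finally show ?thesis using True by (simp add: mult.commute add.commute)
qed simp

lemma expectation_large_choose_le:
  assumes "finite V" "0 \<le> p" "p \<le> 1" "K \<ge> 1"
  shows "measure_pmf.expectation (random_subset V p)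
      (\<lambda>A. real (card A choose 2) * of_bool (K < card A))
    \<le> (real K + 1)\<^sup>2 * (real (card V) * p) ^ (K + 1)"
proof -
  have "measure_pmf.expectation (random_subset V p)
      (\<lambda>A. real (card A choose 2) * of_bool (K < card A))
    \<le> measure_pmf.expectation (random_subset V p)
      (\<lambda>A. (real K + 1)\<^sup>2 * real (card A choose (K + 1)))"
    by (intro expectation_mono_random_subset choose_2_mult_of_bool_le assms)
  also have "\<dots> = (real K + 1)\<^sup>2 * (real (card V choose (K + 1)) * p ^ (K + 1))"
    by (simp add: expectation_card_choose[OF assms(1-3)] del: power_Suc)
  also have "\<dots> \<le> (real K + 1)\<^sup>2 * (real (card V) ^ (K + 1) * p ^ (K + 1))"
    using assms by (intro mult_left_mono mult_right_mono binomial_le_power) auto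
  finally show ?thesis by (simp only: power_mult_distrib)
qed

lemma pair_sum_diff_trunc_le:
  assumes "finite A" "\<And>u. u \<in> A \<Longrightarrow> \<bar>y u\<bar> \<le> c"
  shows "\<bar>pair_sum y A - trunc_pair_sum K y A\<bar> \<le> c\<^sup>2 * (real (card A choose 2) * of_bool (K < card A))"
  using abs_pair_sum_le[OF assms] by (simp add: trunc_pair_sum_def)

lemma abs_trunc_pair_sum_le:
  assumes "finite A" "\<And>u. u \<in> A \<Longrightarrow> \<bar>y u\<bar> \<le> 2"
  shows "\<bar>trunc_pair_sum K y A\<bar> \<le> 4 * (real K)\<^sup>2"
proof (cases "card A \<le> K")
  case True
  have "\<bar>pair_sum y A\<bar> \<le> 2\<^sup>2 * real (card A choose 2)" by (rule abs_pair_sum_le[OF assms])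
  also have "\<dots> \<le> 2\<^sup>2 * (real (card A))\<^sup>2" by (intro mult_left_mono binomial_le_power) auto
  also have "\<dots> \<le> 2\<^sup>2 * (real K)\<^sup>2" using True by (intro mult_left_mono power_mono) auto
  finally show ?thesis by (simp add: trunc_pair_sum_def)
qed (simp add: trunc_pair_sum_def)

lemma trunc_pair_sum_eq_0:
  assumes "finite A" "card A < 2"
  shows "trunc_pair_sum K y A = 0"
proof -
  have "card e \<noteq> 2" if "e \<subseteq> A" for e
    using card_mono[OF assms(1) that] assms(2) by linarith
  then have "pairs A = {}" by (auto simp: pairs_def)
  then show ?thesis by (simp add: trunc_pair_sum_def pair_sum_def)
qed

text \<open>Here centring pays off: the untruncated mean is \<open>p\<^sup>2 * pair_sum y V\<close>,
  nonpositive by \<open>pair_sum_eq\<close>, so only the truncation error remains.\<close>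

lemma expectation_trunc_pair_sum_le:
  assumes V: "finite V" "0 \<le> p" "p \<le> 1" "K \<ge> 1"
    and y: "\<And>u. u \<in> V \<Longrightarrow> \<bar>y u\<bar> \<le> 2" "(\<Sum>u\<in>V. y u) = 0"
  shows "measure_pmf.expectation (random_subset V p) (trunc_pair_sum K y)
    \<le> 4 * ((real K + 1)\<^sup>2 * (real (card V) * p) ^ (K + 1))"
proof -
  let ?E = "measure_pmf.expectation (random_subset V p)"
  let ?g = "\<lambda>A. real (card A choose 2) * of_bool (K < card A)"
  have int: "integrable (random_subset V p) f" for f :: "_ \<Rightarrow> real"
    by (intro integrable_measure_pmf_finite finite_set_random_subset V)
  have "?E (trunc_pair_sum K y) \<le> ?E (\<lambda>A. pair_sum y A + 4 * ?g A)"
  proof (rule expectation_mono_random_subset[OF V(1)])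
    fix A assume A: "A \<subseteq> V"
    then have "finite A" using V(1) by (rule finite_subset)
    then have "\<bar>pair_sum y A - trunc_pair_sum K y A\<bar> \<le> 2\<^sup>2 * ?g A"
      using A y(1) by (intro pair_sum_diff_trunc_le) auto
    then show "trunc_pair_sum K y A \<le> pair_sum y A + 4 * ?g A" unfolding abs_le_iff by simp
  qed
  also have "\<dots> = ?E (pair_sum y) + 4 * ?E ?g"
    by (subst Bochner_Integration.integral_add[OF int int]) simp
  also have "?E (pair_sum y) = p\<^sup>2 * pair_sum y V" by (rule expectation_pair_sum[OF V(1-3)])
  also have "\<dots> \<le> 0"
  proof (rule mult_nonneg_nonpos)
    have "0 \<le> (\<Sum>u\<in>V. (y u)\<^sup>2)" by (rule sum_nonneg) simp
    then show "pair_sum y V \<le> 0" using pair_sum_eq[OF V(1), of y] y(2) by simp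
  qed simp
  finally show ?thesis using expectation_large_choose_le[OF V] by linarith
qed

lemma expectation_trunc_pair_sum_one_ge:
  assumes V: "finite V" "0 \<le> p" "p \<le> 1" "K \<ge> 1"
  shows "measure_pmf.expectation (random_subset V p) (trunc_pair_sum K (\<lambda>_. 1))
    \<ge> real (card V choose 2) * p\<^sup>2 - (real K + 1)\<^sup>2 * (real (card V) * p) ^ (K + 1)"
proof -
  let ?E = "measure_pmf.expectation (random_subset V p)"
  let ?g = "\<lambda>A. real (card A choose 2) * of_bool (K < card A)"
  have int: "integrable (random_subset V p) f" for f :: "_ \<Rightarrow> real"
    by (intro integrable_measure_pmf_finite finite_set_random_subset V)
  have "real (card V choose 2) * p\<^sup>2 - ?E ?g = ?E (\<lambda>A. real (card A choose 2) - ?g A)"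
    using expectation_card_choose[OF V(1-3), of 2]
    by (subst Bochner_Integration.integral_diff[OF int int]) simp
  also have "\<dots> \<le> ?E (trunc_pair_sum K (\<lambda>_. 1))"
    by (rule expectation_mono_random_subset[OF V(1)])
      (auto simp: trunc_pair_sum_def pair_sum_one dest: finite_subset[OF _ V(1)])
  finally show ?thesis using expectation_large_choose_le[OF V] by linarith
qed

section \<open>Probabilities of the four exceptional events\<close>

text \<open>The constant \<open>c\<close> is \<open>B\<^sup>2 * exp B\<close> for the bound
  \<open>B = 4 * K\<^sup>2\<close> on a truncated contribution. The 2 in \<open>c + 2\<close> leaves
  \<open>exp (- 2)\<close> per vertex, enough against the \<open>2 ^ card V\<close> subsets;
  \<open>d \<ge> 1\<close> is what admits \<open>l = 1 / sqrt d\<close>.\<close>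

lemma prob_exists_large_cut_le:
  fixes V :: "'a set" and W :: "'b set" and p :: real and K :: nat
  defines "c \<equiv> (4 * (real K)\<^sup>2)\<^sup>2 * exp (4 * (real K)\<^sup>2)"
    and "d \<equiv> real (card V) * real (card W) * p\<^sup>2"
  assumes V: "finite V" "0 \<le> p" "p \<le> 1" "K \<ge> 1" and W: "finite W" and d: "d \<ge> 1"
  shows "measure_pmf.prob (Pi_pmf (V \<times> W) False (\<lambda>_. bernoulli_pmf p))
      {X. \<exists>S\<subseteq>V. (c + 2) * real (card V) * sqrt d
          + 4 * real (card W) * ((real K + 1)\<^sup>2 * (real (card V) * p) ^ (K + 1))
        \<le> (\<Sum>w\<in>W. trunc_pair_sum K (centred_sign V S) {v\<in>V. X (v, w)})}
    \<le> (2 * exp (- 2)) ^ card V"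
proof -
  let ?P = "Pi_pmf (V \<times> W) False (\<lambda>_. bernoulli_pmf p)"
  define \<rho> where "\<rho> = (real K + 1)\<^sup>2 * (real (card V) * p) ^ (K + 1)"
  define t where "t = (c + 2) * real (card V) * sqrt d + 4 * real (card W) * \<rho>"
  define Bad where "Bad S = {X. t \<le> (\<Sum>w\<in>W. trunc_pair_sum K (centred_sign V S) {v\<in>V. X (v, w)})}"
    for S
  have each: "measure_pmf.prob ?P (Bad S) \<le> exp (- 2) ^ card V" for S
  proof -
    let ?h = "trunc_pair_sum K (centred_sign V S)"
    define l where "l = 1 / sqrt d"
    have l: "0 < l" "l \<le> 1" using d by (auto simp: l_def)
    have ld: "l * sqrt d = 1" "l\<^sup>2 * d = 1" using d by (auto simp: l_def power_divide)
    have "measure_pmf.prob ?P (Bad S)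
        \<le> exp (real (card W) * (l * (4 * \<rho>) + l\<^sup>2 * c * (real (card V) * p)\<^sup>2) - l * t)"
      unfolding Bad_def c_def
    proof (rule prob_sum_columns_ge[OF V(1-3) W _ _ l])
      show "\<bar>?h A\<bar> \<le> 4 * (real K)\<^sup>2" if "A \<subseteq> V" for A
        using that V(1) abs_centred_sign_le by (intro abs_trunc_pair_sum_le) (auto dest: finite_subset)
      show "?h A = 0" if "A \<subseteq> V" "card A < 2" for A
        using that V(1) by (intro trunc_pair_sum_eq_0) (auto dest: finite_subset)
      show "measure_pmf.expectation (random_subset V p) ?h \<le> 4 * \<rho>"
        unfolding \<rho>_def
        by (intro expectation_trunc_pair_sum_le V abs_centred_sign_le sum_centred_sign)
    qed
    \<comment> \<open>The second summand of \<open>t\<close> cancels the bound on the means exactly.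
      In the quadratic term, \<open>card W * (card V * p)^2\<close> is
      \<open>card V * d\<close>.\<close>
    also have "real (card W) * (l * (4 * \<rho>) + l\<^sup>2 * c * (real (card V) * p)\<^sup>2) - l * t
        = c * real (card V) * (l\<^sup>2 * d) - (c + 2) * real (card V) * (l * sqrt d)"
      by (simp add: t_def d_def algebra_simps power2_eq_square)
    also have "\<dots> = real (card V) * - 2" unfolding ld by (simp add: algebra_simps)
    finally show ?thesis by (simp only: exp_of_nat_mult)
  qed
  have "{X. \<exists>S\<subseteq>V. t \<le> (\<Sum>w\<in>W. trunc_pair_sum K (centred_sign V S) {v\<in>V. X (v, w)})}
      = (\<Union>S\<in>Pow V. Bad S)" by (auto simp: Bad_def)
  then have "measure_pmf.prob ?P
      {X. \<exists>S\<subseteq>V. t \<le> (\<Sum>w\<in>W. trunc_pair_sum K (centred_sign V S) {v\<in>V. X (v, w)})}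
      \<le> (\<Sum>S\<in>Pow V. measure_pmf.prob ?P (Bad S))"
    using V(1) by (simp only:) (intro measure_pmf.finite_measure_subadditive_finite, auto)
  also have "\<dots> \<le> (\<Sum>S\<in>Pow V. exp (- 2) ^ card V)" by (intro sum_mono each)
  also have "\<dots> = (2 * exp (- 2)) ^ card V" using V(1) by (simp add: card_Pow power_mult_distrib)
  finally show ?thesis unfolding t_def \<rho>_def .
qed

text \<open>The lower tail comes from the upper-tail bound for the negated sum. The mean of the sum
  is at least \<open>card V * d / 8\<close>, twice the threshold; no union over subsets is involved,
  so any geometric decay in \<open>card V\<close> suffices.\<close>

lemma prob_few_pairs_le:
  fixes V :: "'a set" and W :: "'b set" and p :: real and K :: nat
  defines "c \<equiv> (4 * (real K)\<^sup>2)\<^sup>2 * exp (4 * (real K)\<^sup>2)"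
    and "d \<equiv> real (card V) * real (card W) * p\<^sup>2"
  assumes V: "finite V" "0 \<le> p" "p \<le> 1" "K \<ge> 1" and W: "finite W" and d: "d \<ge> 1"
    and card: "card V \<ge> 2" and small: "(real K + 1)\<^sup>2 * (real (card V) * p) ^ (K - 1) \<le> 1 / 8"
  shows "measure_pmf.prob (Pi_pmf (V \<times> W) False (\<lambda>_. bernoulli_pmf p))
      {X. (\<Sum>w\<in>W. trunc_pair_sum K (\<lambda>_. 1) {v\<in>V. X (v, w)}) \<le> real (card V) * d / 16}
    \<le> exp (- 1 / (32 * (1 + 32 * c))) ^ card V"
proof -
  let ?P = "Pi_pmf (V \<times> W) False (\<lambda>_. bernoulli_pmf p)"
  define x where "x = real (card V) * p"
  have c: "c \<ge> 0" by (simp add: c_def)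
  \<comment> \<open>Makes \<open>l * c\<close> at most 1/32, so that the quadratic term uses up at
    most half of the gain 1/16 left between mean and threshold.\<close>
  define l where "l = 1 / (1 + 32 * c)"
  have l: "0 < l" "l \<le> 1" using c by (auto simp: l_def)
  have lc: "l * c \<le> 1 / 32" using c by (simp add: l_def field_simps)
  have nd: "real (card V) * d = real (card W) * x\<^sup>2"
    by (simp add: d_def x_def power2_eq_square)
  \<comment> \<open>For at least two vertices \<open>card V choose 2\<close> is at least a quarter
    of the square, which gives \<open>x^2 / 4\<close>; by \<open>small\<close> the truncation
    removes at most half of that.\<close>
  have mean: "measure_pmf.expectation (random_subset V p) (trunc_pair_sum K (\<lambda>_. 1)) \<ge> x\<^sup>2 / 8"
  proof -
    have "real (card V choose 2) = real (card V) * (real (card V) - 1) / 2"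
      using card by (simp add: choose_two real_of_nat_div of_nat_diff)
    moreover have "real (card V) * (real (card V) / 2) \<le> real (card V) * (real (card V) - 1)"
      using card by (intro mult_left_mono) auto
    ultimately have "(real (card V))\<^sup>2 / 4 \<le> real (card V choose 2)"
      by (simp add: power2_eq_square)
    then have "(real (card V))\<^sup>2 / 4 * p\<^sup>2 \<le> real (card V choose 2) * p\<^sup>2"
      by (rule mult_right_mono) simp
    then have 1: "x\<^sup>2 / 4 \<le> real (card V choose 2) * p\<^sup>2" by (simp add: x_def power_mult_distrib)
    have "(real K + 1)\<^sup>2 * x ^ (K + 1) = (real K + 1)\<^sup>2 * x ^ (K - 1) * x\<^sup>2"
      using V(4) by (simp add: power_add[symmetric] mult.assoc)
    also have "\<dots> \<le> 1 / 8 * x\<^sup>2" using small by (intro mult_right_mono) (auto simp: x_def)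
    finally show ?thesis
      using 1 expectation_trunc_pair_sum_one_ge[OF V] by (simp add: x_def)
  qed
  have "measure_pmf.prob ?P
      {X. - (real (card V) * d / 16) \<le> (\<Sum>w\<in>W. - trunc_pair_sum K (\<lambda>_. 1) {v\<in>V. X (v, w)})}
    \<le> exp (real (card W) * (l * - (x\<^sup>2 / 8) + l\<^sup>2 * c * x\<^sup>2) - l * - (real (card V) * d / 16))"
    unfolding c_def x_def
  proof (rule prob_sum_columns_ge[OF V(1-3) W _ _ l])
    show "\<bar>- trunc_pair_sum K (\<lambda>_. 1) A\<bar> \<le> 4 * (real K)\<^sup>2" if "A \<subseteq> V" for A
      using that V(1) by (auto intro!: abs_trunc_pair_sum_le dest: finite_subset)
    show "- trunc_pair_sum K (\<lambda>_. 1) A = 0" if "A \<subseteq> V" "card A < 2" for A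
      using that V(1) by (auto intro!: trunc_pair_sum_eq_0 dest: finite_subset)
    show "measure_pmf.expectation (random_subset V p) (\<lambda>A. - trunc_pair_sum K (\<lambda>_. 1) A)
        \<le> - ((real (card V) * p)\<^sup>2 / 8)"
      using mean by (simp add: x_def)
  qed
  also have "\<dots> \<le> exp (real (card V) * (- 1 / (32 * (1 + 32 * c))))"
  proof -
    have "real (card W) * (l * - (x\<^sup>2 / 8) + l\<^sup>2 * c * x\<^sup>2) - l * - (real (card V) * d / 16)
        = real (card V) * d * l * (l * c - 1 / 16)"
      unfolding nd by (simp add: algebra_simps power2_eq_square)
    also have "\<dots> \<le> real (card V) * d * l * (- 1 / 32)"
      using lc l d by (intro mult_left_mono mult_nonneg_nonneg) auto
    also have "\<dots> = - (d * (real (card V) * l / 32))" by simp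
    also have "\<dots> \<le> - (1 * (real (card V) * l / 32))"
      using d l by (intro le_imp_neg_le mult_right_mono) auto
    also have "\<dots> = real (card V) * (- 1 / (32 * (1 + 32 * c)))" by (simp add: l_def)
    finally show ?thesis by simp
  qed
  finally show ?thesis unfolding exp_of_nat_mult by (simp add: sum_negf)
qed

text \<open>With the cap \<open>a + 2\<close> the expectation is of order
  \<open>m * x^(a+3)\<close>. The threshold \<open>m * x^(a+2)\<close> is larger by a factor
  \<open>1 / x\<close>, so Markov's inequality gives a probability of order
  \<open>x\<close>.\<close>

lemma prob_large_columns_le:
  fixes V :: "'a set" and W :: "'b set" and p :: real and a :: nat
  defines "x \<equiv> real (card V) * p"
  assumes V: "finite V" "0 < p" "p \<le> 1" "V \<noteq> {}" and W: "finite W" "W \<noteq> {}"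
  shows "measure_pmf.prob (Pi_pmf (V \<times> W) False (\<lambda>_. bernoulli_pmf p))
      {X. real (card W) * x\<^sup>2 * x ^ a \<le>
        (\<Sum>w\<in>W. real (card {v\<in>V. X (v, w)} choose 2) * of_bool (a + 2 < card {v\<in>V. X (v, w)}))}
    \<le> (real a + 3)\<^sup>2 * x"
proof -
  let ?P = "Pi_pmf (V \<times> W) False (\<lambda>_. bernoulli_pmf p)"
  let ?g = "\<lambda>A :: 'a set. real (card A choose 2) * of_bool (a + 2 < card A)"
  have x: "x > 0" using V by (simp add: x_def card_gt_0_iff)
  have m: "real (card W) > 0" using W by (simp add: card_gt_0_iff)
  have "measure_pmf.prob ?P {X. real (card W) * x\<^sup>2 * x ^ a \<le> (\<Sum>w\<in>W. ?g {v\<in>V. X (v, w)})}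
      \<le> measure_pmf.expectation ?P (\<lambda>X. \<Sum>w\<in>W. ?g {v\<in>V. X (v, w)}) / (real (card W) * x\<^sup>2 * x ^ a)"
    using integral_Markov_inequality_measure[of "measure_pmf ?P"
        "\<lambda>X. \<Sum>w\<in>W. ?g {v\<in>V. X (v, w)}" UNIV "real (card W) * x\<^sup>2 * x ^ a"] V W x m
    by (simp add: sum_nonneg integrable_measure_pmf_finite finite_set_Pi_bernoulli)
  also have "measure_pmf.expectation ?P (\<lambda>X. \<Sum>w\<in>W. ?g {v\<in>V. X (v, w)})
      = real (card W) * measure_pmf.expectation (random_subset V p) ?g"
    by (rule expectation_sum_columns[OF V(1) W(1)])
  also have "real (card W) * measure_pmf.expectation (random_subset V p) ?g /
      (real (card W) * x\<^sup>2 * x ^ a) = measure_pmf.expectation (random_subset V p) ?g / (x\<^sup>2 * x ^ a)"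
    using m by simp
  also have "\<dots> \<le> (real (a + 2) + 1)\<^sup>2 * x ^ (a + 2 + 1) / (x\<^sup>2 * x ^ a)"
    using expectation_large_choose_le[of V p "a + 2"] V x
    by (intro divide_right_mono) (auto simp: x_def)
  also have "\<dots> = (real a + 3)\<^sup>2 * x"
    using x by (simp add: power_add power2_eq_square add.commute)
  finally show ?thesis .
qed

text \<open>The sum counts vertex pairs with attribute pairs for which all four incidences are
  present, an event of probability \<open>p ^ 4\<close>. Hence its expectation is at most
  \<open>z\<^sup>2\<close>, and Markov's inequality applies.\<close>

lemma prob_multiple_pairs_le:
  fixes V :: "'a set" and W :: "'b set" and p \<omega> :: real
  defines "z \<equiv> real (card V) * real (card W) * p\<^sup>2"
  assumes V: "finite V" "0 < p" "p \<le> 1" "V \<noteq> {}" and W: "finite W" "W \<noteq> {}" and \<omega>: "\<omega> > 0"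
  shows "measure_pmf.prob (Pi_pmf (V \<times> W) False (\<lambda>_. bernoulli_pmf p))
      {X. \<omega> * z\<^sup>2 \<le> (\<Sum>e\<in>pairs V. real (card {w\<in>W. e \<subseteq> {v\<in>V. X (v, w)}} choose 2))}
    \<le> 1 / \<omega>"
proof -
  let ?P = "Pi_pmf (V \<times> W) False (\<lambda>_. bernoulli_pmf p)"
  let ?D = "\<lambda>X. \<Sum>e\<in>pairs V. real (card {w\<in>W. e \<subseteq> {v\<in>V. X (v, w)}} choose 2)"
  have z: "z > 0" using V W by (simp add: z_def card_gt_0_iff)
  have D: "?D X = (\<Sum>i\<in>pairs V \<times> pairs W. 1 * of_bool (\<forall>q\<in>fst i \<times> snd i. X q))" for X
  proof -
    have "real (card {w\<in>W. e \<subseteq> {v\<in>V. X (v, w)}} choose 2)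
        = (\<Sum>T\<in>pairs W. of_bool (\<forall>q\<in>e \<times> T. X q))" if e: "e \<in> pairs V" for e
    proof -
      have "{T \<in> pairs W. \<forall>q\<in>e \<times> T. X q} = pairs {w\<in>W. e \<subseteq> {v\<in>V. X (v, w)}}"
        using e by (fastforce simp: pairs_def)
      then show ?thesis
        using W(1) card_pairs[of "{w\<in>W. e \<subseteq> {v\<in>V. X (v, w)}}"]
        by (simp add: of_bool_def sum.If_cases Int_def finite_pairs)
    qed
    then show ?thesis by (simp add: sum.cartesian_product case_prod_unfold)
  qed
  have "measure_pmf.expectation ?P ?D
      = (\<Sum>i\<in>pairs V \<times> pairs W. 1 * p ^ card (fst i \<times> snd i))"
    unfolding D by (rule expectation_sum_all_true) (use V W in \<open>auto simp: pairs_def\<close>)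
  also have "\<dots> = (\<Sum>i\<in>pairs V \<times> pairs W. p ^ 4)"
    by (intro sum.cong) (auto simp: pairs_def card_cartesian_product)
  also have "\<dots> = real (card V choose 2) * real (card W choose 2) * p ^ 4"
    using V W by (simp add: card_cartesian_product card_pairs)
  also have "\<dots> \<le> (real (card V))\<^sup>2 * (real (card W))\<^sup>2 * p ^ 4"
    using V(2) by (intro mult_mono binomial_le_power) auto
  also have "\<dots> = z\<^sup>2" by (simp add: z_def power_mult_distrib flip: power_mult)
  finally have E: "measure_pmf.expectation ?P ?D \<le> z\<^sup>2" .
  have "measure_pmf.prob ?P {X. \<omega> * z\<^sup>2 \<le> ?D X} \<le> measure_pmf.expectation ?P ?D / (\<omega> * z\<^sup>2)"
    using integral_Markov_inequality_measure[of "measure_pmf ?P" ?D UNIV "\<omega> * z\<^sup>2"] V W z \<omega>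
    by (simp add: sum_nonneg integrable_measure_pmf_finite finite_set_Pi_bernoulli)
  also have "\<dots> \<le> z\<^sup>2 / (\<omega> * z\<^sup>2)" using E z \<omega> by (intro divide_right_mono) auto
  also have "\<dots> = 1 / \<omega>" using z by simp
  finally show ?thesis .
qed

section \<open>The modularity bound\<close>

text \<open>The deterministic half of the argument. The edge sum of a centred sign vector is at most
  \<open>t + 4 * r + 4 * \<delta>\<close>, with 4 the square of the bound 2 on its entries, and
  there are at least \<open>s - \<delta>\<close> edges, which is at least \<open>s / 2\<close> when
  \<open>\<delta>\<close> is small.\<close>

lemma modularity_intersection_graph_le:
  fixes n m K :: nat and X :: "nat \<times> nat \<Rightarrow> bool" and t s r \<delta> :: real
  defines "H \<equiv> \<lambda>w. {v\<in>{1..n}. X (v, w)}"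
  defines "D \<equiv> \<Sum>e\<in>pairs {1..n}. real (card {w\<in>{1..m}. e \<subseteq> H w} choose 2)"
  assumes cut: "\<And>S. S \<subseteq> {1..n} \<Longrightarrow> (\<Sum>w\<in>{1..m}. trunc_pair_sum K (centred_sign {1..n} S) (H w)) \<le> t"
    and many: "s \<le> (\<Sum>w\<in>{1..m}. trunc_pair_sum K (\<lambda>_. 1) (H w))"
    and large: "(\<Sum>w\<in>{1..m}. real (card (H w) choose 2) * of_bool (K < card (H w))) \<le> r"
    and multiple: "D \<le> \<delta>"
    and "0 \<le> t" "0 < s"
  shows "modularity (intersection_graph n (attributes m X)) \<le> 2 * (t + 4 * r + 4 * \<delta>) / s + 8 * \<delta> / s"
proof -
  define V where "V = {1..n}"
  define E where "E = {e\<in>pairs V. \<exists>w\<in>{1..m}. e \<subseteq> H w}"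
  have G: "intersection_graph n (attributes m X) = (V, E)"
    unfolding intersection_graph_eq E_def V_def H_def by simp
  have V: "finite V" "E \<subseteq> pairs V" by (auto simp: V_def E_def)
  have H: "H w \<subseteq> V" "finite (H w)" for w by (auto simp: H_def V_def)
  have D: "0 \<le> D" unfolding D_def by (intro sum_nonneg) auto
  have r: "0 \<le> r" using large by (intro order.trans[OF _ large] sum_nonneg) auto
  have approx: "\<bar>(\<Sum>e\<in>E. \<Prod>u\<in>e. y u) - (\<Sum>w\<in>{1..m}. pair_sum y (H w))\<bar> \<le> c\<^sup>2 * D"
    if "\<And>u. \<bar>y u\<bar> \<le> c" for y :: "nat \<Rightarrow> real" and c
    using sum_edges_approx[of V "{1..m}" H y c] V(1) H that by (simp add: E_def D_def V_def)
  have edges: "s - \<delta> \<le> real (card E)"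
  proof -
    have "s \<le> (\<Sum>w\<in>{1..m}. pair_sum (\<lambda>_. 1) (H w))"
      by (rule order.trans[OF many]) (intro sum_mono, simp add: trunc_pair_sum_def pair_sum_one H)
    moreover have "\<bar>real (card E) - (\<Sum>w\<in>{1..m}. pair_sum (\<lambda>_. 1) (H w))\<bar> \<le> D"
      using approx[of "\<lambda>_. 1" 1] by simp
    ultimately show ?thesis using multiple by linarith
  qed
  have sum_le: "(\<Sum>e\<in>E. \<Prod>u\<in>e. centred_sign V S u) \<le> t + 4 * r + 4 * \<delta>" if "S \<subseteq> V" for S
  proof -
    let ?y = "centred_sign V S"
    have "pair_sum ?y (H w) \<le> trunc_pair_sum K ?y (H w)
        + 4 * (real (card (H w) choose 2) * of_bool (K < card (H w)))" for w
      using pair_sum_diff_trunc_le[OF H(2), of w ?y 2 K, OF abs_centred_sign_le]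
      unfolding abs_le_iff by simp
    then have "(\<Sum>w\<in>{1..m}. pair_sum ?y (H w)) \<le> (\<Sum>w\<in>{1..m}. trunc_pair_sum K ?y (H w))
        + 4 * (\<Sum>w\<in>{1..m}. real (card (H w) choose 2) * of_bool (K < card (H w)))"
      unfolding sum_distrib_left sum.distrib[symmetric] by (intro sum_mono)
    also have "\<dots> \<le> t + 4 * r" using cut[of S] that large by (simp add: V_def)
    finally show ?thesis
      using approx[of ?y 2, OF abs_centred_sign_le] multiple unfolding abs_le_iff by simp
  qed
  \<comment> \<open>For \<open>\<delta> > s / 2\<close> the edge count is not controlled, but the modularity is at most 4 anyway.\<close>
  show ?thesis
  proof (cases "\<delta> \<le> s / 2")
    case True
    have "modularity (V, E) \<le> (t + 4 * r + 4 * \<delta>) / real (card E)"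
      by (rule modularity_le[OF V sum_le])
    also have "\<dots> \<le> (t + 4 * r + 4 * \<delta>) / (s / 2)"
      using True edges assms(7,8) r D multiple by (intro divide_left_mono) auto
    also have "\<dots> = 2 * (t + 4 * r + 4 * \<delta>) / s" by simp
    also have "\<dots> \<le> 2 * (t + 4 * r + 4 * \<delta>) / s + 8 * \<delta> / s"
    proof -
      have "0 \<le> 8 * \<delta> / s" using assms(8) D multiple by (intro divide_nonneg_pos) auto
      then show ?thesis by linarith
    qed
    finally show ?thesis by (simp add: G)
  next
    case False
    have "(\<Sum>e\<in>E. \<Prod>u\<in>e. centred_sign V S u) \<le> 4 * real (card E)" for S
    proof -
      have "(\<Prod>u\<in>e. centred_sign V S u) \<le> 4" if "e \<in> E" for e
        using abs_prod_pair_le[of e V "centred_sign V S" 2] that abs_centred_sign_le[of V S]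
        by (auto simp: E_def abs_le_iff)
      then show ?thesis using sum_bounded_above[of E "\<lambda>e. \<Prod>u\<in>e. centred_sign V S u" 4] by simp
    qed
    then have "modularity (V, E) \<le> 4 * real (card E) / real (card E)"
      by (intro modularity_le[OF V])
    also have "\<dots> \<le> 4" by simp
    also have "\<dots> \<le> 8 * \<delta> / s" using False assms(8) by (simp add: field_simps)
    also have "\<dots> \<le> 2 * (t + 4 * r + 4 * \<delta>) / s + 8 * \<delta> / s"
      using assms(7,8) r D multiple by simp
    finally show ?thesis by (simp add: G)
  qed
qed

text \<open>The theorem for fixed \<open>n\<close>, with explicit constants. The factor 32 comes
  from dividing by \<open>s / 2\<close> with \<open>s = n * d / 16\<close>. In \<open>L\<close>, the
  term \<open>128 * (a + 3)^2\<close> pays for the mean of the truncated sums, and 384 is 128 for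
  large attributes plus 256 for multiple edges.\<close>

lemma prob_modularity_le:
  fixes n m a :: nat and p \<omega> :: real
  defines "c \<equiv> (4 * (real (a + 2))\<^sup>2)\<^sup>2 * exp (4 * (real (a + 2))\<^sup>2)"
    and "d \<equiv> real n * real m * p\<^sup>2" and "L \<equiv> 128 * (real a + 3)\<^sup>2 + 384"
  assumes n: "n \<ge> 2" and p: "0 \<le> p" "p \<le> 1" and d: "d \<ge> 1" and \<omega>: "\<omega> > 0"
    and small: "(real a + 3)\<^sup>2 * (real n * p) ^ (a + 1) \<le> 1 / 8" "real n * p \<le> 1"
  shows "1 - ((2 * exp (- 2)) ^ n + exp (- 1 / (32 * (1 + 32 * c))) ^ n
        + (real a + 3)\<^sup>2 * (real n * p) + 1 / \<omega>)
    \<le> measure_pmf.prob (random_intersection_graph n m p)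
        {G. modularity G \<le> 32 * (c + 2) / sqrt d + L * ((real n * p) ^ a + \<omega> * real m * p\<^sup>2)}"
proof -
  let ?P = "Pi_pmf ({1..n} \<times> {1..m}) False (\<lambda>_. bernoulli_pmf p)"
  let ?H = "\<lambda>X w. {v\<in>{1..n}. X (v, w)}"
  define x where "x = real n * p"
  define \<rho> where "\<rho> = (real (a + 2) + 1)\<^sup>2 * x ^ (a + 2 + 1)"
  \<comment> \<open>Relative to \<open>n * d = m * x^2\<close>, the quantity \<open>t\<close> gives
    \<open>(c + 2) / sqrt d\<close> plus order \<open>x^(a+1)\<close>, \<open>r\<close> gives
    \<open>x^a\<close>, and \<open>\<delta>\<close> gives \<open>\<omega> * m * p^2\<close>.\<close>
  define t where "t = (c + 2) * real n * sqrt d + 4 * real m * \<rho>"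
  define s where "s = real n * d / 16"
  define r where "r = real m * x\<^sup>2 * x ^ a"
  define \<delta> where "\<delta> = \<omega> * d\<^sup>2"
  have pos: "p > 0" "m > 0"
    using d p by (auto simp: d_def less_eq_real_def intro: ccontr)
  have x: "0 < x" using n pos by (simp add: x_def)
  have c: "0 \<le> c" by (simp add: c_def)
  have nd: "real n * d = real m * x\<^sup>2" by (simp add: d_def x_def power2_eq_square)
  have t: "0 \<le> t" using c d x by (simp add: t_def \<rho>_def)
  have s: "0 < s" using n d by (simp add: s_def)
  define B1 where "B1 = {X. \<exists>S\<subseteq>{1..n}. t \<le>
    (\<Sum>w\<in>{1..m}. trunc_pair_sum (a + 2) (centred_sign {1..n} S) (?H X w))}"
  define B2 where "B2 = {X. (\<Sum>w\<in>{1..m}. trunc_pair_sum (a + 2) (\<lambda>_. 1) (?H X w)) \<le> s}"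
  define B3 where "B3 = {X. r \<le>
    (\<Sum>w\<in>{1..m}. real (card (?H X w) choose 2) * of_bool (a + 2 < card (?H X w)))}"
  define B4 where "B4 = {X. \<delta> \<le>
    (\<Sum>e\<in>pairs {1..n}. real (card {w\<in>{1..m}. e \<subseteq> ?H X w} choose 2))}"
  have fin: "finite {1..n}" "finite {1..m}" and cn: "card {1..n} = n" and cm: "card {1..m} = m"
    and ne: "{1..n} \<noteq> {}" "{1..m} \<noteq> {}"
    using n pos by auto
  have K: "1 \<le> a + 2" and K': "(real (a + 2) + 1)\<^sup>2 * (real n * p) ^ (a + 2 - 1) \<le> 1 / 8"
    using small(1) by (simp_all add: add.commute)
  have b1: "measure_pmf.prob ?P B1 \<le> (2 * exp (- 2)) ^ n"
    unfolding B1_def t_def \<rho>_def x_def c_def d_def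
    by (rule prob_exists_large_cut_le[OF fin(1) p K fin(2), unfolded cn cm, OF d[unfolded d_def]])
  have b2: "measure_pmf.prob ?P B2 \<le> exp (- 1 / (32 * (1 + 32 * c))) ^ n"
    unfolding B2_def s_def c_def d_def
    by (rule prob_few_pairs_le[OF fin(1) p K fin(2), unfolded cn cm, OF d[unfolded d_def] n K'])
  have b3: "measure_pmf.prob ?P B3 \<le> (real a + 3)\<^sup>2 * x"
    unfolding B3_def r_def x_def
    by (rule prob_large_columns_le[OF fin(1) pos(1) p(2) ne(1) fin(2) ne(2), unfolded cn cm])
  have b4: "measure_pmf.prob ?P B4 \<le> 1 / \<omega>"
    unfolding B4_def \<delta>_def d_def
    by (rule prob_multiple_pairs_le[OF fin(1) pos(1) p(2) ne(1) fin(2) ne(2) \<omega>, unfolded cn cm])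
  define Bad where "Bad = B1 \<union> B2 \<union> B3 \<union> B4"
  have "measure_pmf.prob ?P Bad \<le> measure_pmf.prob ?P B1 + measure_pmf.prob ?P B2
      + measure_pmf.prob ?P B3 + measure_pmf.prob ?P B4"
    unfolding Bad_def
    by (intro order.trans[OF measure_Un_le] add_mono order_refl) auto
  then have bad: "measure_pmf.prob ?P Bad \<le> (2 * exp (- 2)) ^ n + exp (- 1 / (32 * (1 + 32 * c))) ^ n
      + (real a + 3)\<^sup>2 * x + 1 / \<omega>"
    using b1 b2 b3 b4 by linarith
  define bound where "bound = 32 * (c + 2) / sqrt d + L * (x ^ a + \<omega> * real m * p\<^sup>2)"
  have good: "modularity (intersection_graph n (attributes m X)) \<le> bound" if "X \<notin> Bad" for X
  proof -
    have X: "X \<notin> B1" "X \<notin> B2" "X \<notin> B3" "X \<notin> B4" using that by (auto simp: Bad_def)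
    have "modularity (intersection_graph n (attributes m X)) \<le> 2 * (t + 4 * r + 4 * \<delta>) / s + 8 * \<delta> / s"
    proof (rule modularity_intersection_graph_le[where K = "a + 2"])
      show "(\<Sum>w\<in>{1..m}. trunc_pair_sum (a + 2) (centred_sign {1..n} S) (?H X w)) \<le> t"
        if "S \<subseteq> {1..n}" for S
      proof -
        have "\<not> t \<le> (\<Sum>w\<in>{1..m}. trunc_pair_sum (a + 2) (centred_sign {1..n} S) (?H X w))"
          using X(1) that unfolding B1_def by blast
        then show ?thesis unfolding not_le by (rule less_imp_le)
      qed
      show "s \<le> (\<Sum>w\<in>{1..m}. trunc_pair_sum (a + 2) (\<lambda>_. 1) (?H X w))"
        using X(2) unfolding B2_def mem_Collect_eq not_le by (rule less_imp_le)
      show "(\<Sum>w\<in>{1..m}. real (card (?H X w) choose 2) * of_bool (a + 2 < card (?H X w))) \<le> r"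
        using X(3) unfolding B3_def mem_Collect_eq not_le by (rule less_imp_le)
      show "(\<Sum>e\<in>pairs {1..n}. real (card {w\<in>{1..m}. e \<subseteq> ?H X w} choose 2)) \<le> \<delta>"
        using X(4) unfolding B4_def mem_Collect_eq not_le by (rule less_imp_le)
    qed (fact t s)+
    also have "\<dots> = 32 * t / (real n * d) + 128 * (r / (real n * d)) + 256 * (\<delta> / (real n * d))"
      by (simp add: s_def add_divide_distrib)
    finally have mod: "modularity (intersection_graph n (attributes m X)) \<le>
      32 * (t / (real n * d)) + 128 * (r / (real n * d)) + 256 * (\<delta> / (real n * d))" by simp
    have t_eq: "t / (real n * d) = (c + 2) / sqrt d + 4 * (real a + 3)\<^sup>2 * x ^ (a + 1)"
    proof -
      have "(c + 2) * real n * sqrt d / (real n * d) = (c + 2) / sqrt d"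
        using n d by (simp add: field_simps)
      moreover have "4 * real m * \<rho> = 4 * (real a + 3)\<^sup>2 * x ^ (a + 1) * (real n * d)"
        unfolding nd \<rho>_def by (simp add: power2_eq_square add.commute)
      moreover have "real n * d \<noteq> 0" using n d by simp
      ultimately show ?thesis
        by (simp only: t_def add_divide_distrib[of _ _ "real n * d"] nonzero_mult_div_cancel_right
            not_False_eq_True)
    qed
    have r_eq: "r / (real n * d) = x ^ a"
      unfolding nd r_def using pos x by simp
    have \<delta>_eq: "\<delta> / (real n * d) = \<omega> * real m * p\<^sup>2"
    proof -
      have "\<delta> = \<omega> * real m * p\<^sup>2 * (real n * d)"
        by (simp add: \<delta>_def d_def power2_eq_square)
      then show ?thesis using n d by simp
    qed
    note mod
    also have "32 * (t / (real n * d)) + 128 * (r / (real n * d)) + 256 * (\<delta> / (real n * d)) =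
      32 * ((c + 2) / sqrt d + 4 * (real a + 3)\<^sup>2 * x ^ (a + 1)) + 128 * x ^ a
        + 256 * (\<omega> * real m * p\<^sup>2)" unfolding t_eq r_eq \<delta>_eq ..
    also have "\<dots> \<le> bound"
    proof -
      have "x ^ (a + 1) \<le> x ^ a"
        using small(2) x by (intro power_decreasing) (auto simp: x_def)
      then have "(real a + 3)\<^sup>2 * x ^ (a + 1) \<le> (real a + 3)\<^sup>2 * x ^ a"
        by (rule mult_left_mono) simp
      moreover have "0 \<le> (real a + 3)\<^sup>2 * (\<omega> * real m * p\<^sup>2)" "0 \<le> \<omega> * real m * p\<^sup>2" "0 \<le> x ^ a"
        using \<omega> x by auto
      ultimately show ?thesis unfolding bound_def L_def by (simp add: algebra_simps)
    qed
    finally show ?thesis .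
  qed
  have "1 - measure_pmf.prob ?P Bad = measure_pmf.prob ?P (- Bad)"
    using measure_pmf.prob_compl[of Bad ?P] by (simp add: Compl_eq_Diff_UNIV)
  also have "\<dots> \<le> measure_pmf.prob ?P {X. modularity (intersection_graph n (attributes m X)) \<le> bound}"
    using good by (intro measure_pmf.finite_measure_mono) auto
  also have "\<dots> = measure_pmf.prob (random_intersection_graph n m p) {G. modularity G \<le> bound}"
    by (simp add: random_intersection_graph_def vimage_def)
  finally show ?thesis using bad unfolding bound_def x_def by linarith
qed

theorem theorem3:
  fixes m :: "nat \<Rightarrow> nat" and p :: "nat \<Rightarrow> real"
  assumes "filterlim m at_top sequentially"
    and "\<And>n. 0 \<le> p n" and "\<And>n. p n \<le> 1"
    and "p \<longlonglongrightarrow> 0"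
    and "(\<lambda>n. real n * p n) \<in> o(\<lambda>_. 1)"
    and "(\<lambda>n. real (m n) * (p n)\<^sup>2) \<in> o(\<lambda>_. 1)"
    and "\<forall>\<^sub>F n in sequentially. real n * real (m n) * (p n)\<^sup>2 \<ge> 1"
  shows "\<forall>A>0::real. \<exists>C::real. \<forall>\<omega>::nat \<Rightarrow> real. filterlim \<omega> at_top sequentially \<longrightarrow>
    (\<exists>f::nat \<Rightarrow> real.
       f \<in> O(\<lambda>n. (real n * p n) powr A + \<omega> n * real (m n) * (p n)\<^sup>2) \<and>
       (\<lambda>n. measure_pmf.prob (random_intersection_graph n (m n) (p n))
              {G. modularity G \<le> C / sqrt (real n * real (m n) * (p n)\<^sup>2) + f n})
         \<longlonglongrightarrow> 1)"
proof (intro allI impI)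
  fix A :: real
  assume "A > 0"
  \<comment> \<open>Rounding \<open>A\<close> up to an integer is harmless: \<open>x^a\<close> is at
    most \<open>x powr A\<close> once \<open>x \<le> 1\<close>.\<close>
  define a where "a = nat \<lceil>A\<rceil>"
  have a: "A \<le> real a" by (simp add: a_def real_nat_ceiling_ge)
  define c where "c = (4 * (real (a + 2))\<^sup>2)\<^sup>2 * exp (4 * (real (a + 2))\<^sup>2)"
  define L where "L = 128 * (real a + 3)\<^sup>2 + 384"
  have c: "c \<ge> 0" by (simp add: c_def)
  have L: "L > 0" unfolding L_def by (intro add_nonneg_pos) auto
  define x where "x n = real n * p n" for n
  have x0: "x \<longlonglongrightarrow> 0"
    using assms(5) unfolding x_def using smalloD_tendsto by force
  show "\<exists>C. \<forall>\<omega>. filterlim \<omega> at_top sequentially \<longrightarrow>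
    (\<exists>f. f \<in> O(\<lambda>n. (real n * p n) powr A + \<omega> n * real (m n) * (p n)\<^sup>2) \<and>
       (\<lambda>n. measure_pmf.prob (random_intersection_graph n (m n) (p n))
              {G. modularity G \<le> C / sqrt (real n * real (m n) * (p n)\<^sup>2) + f n}) \<longlonglongrightarrow> 1)"
  \<comment> \<open>This witness depends only on \<open>A\<close>, through \<open>a\<close> and
    \<open>c\<close>, and so precedes the choice of \<open>\<omega>\<close>.\<close>
  proof (intro exI[of _ "32 * (c + 2)"] allI impI)
    fix \<omega> :: "nat \<Rightarrow> real"
    assume \<omega>: "filterlim \<omega> at_top sequentially"
    define f where "f n = L * (x n ^ a + \<omega> n * real (m n) * (p n)\<^sup>2)" for n
    have \<omega>_pos: "\<forall>\<^sub>F n in sequentially. \<omega> n > 0"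
      using \<omega> by (auto simp: filterlim_at_top_dense)
    have x_le: "\<forall>\<^sub>F n in sequentially. x n \<le> 1"
      using order_tendstoD(2)[OF x0, of 1] by (auto elim: eventually_mono)
    have "(\<lambda>n. (real a + 3)\<^sup>2 * x n ^ (a + 1)) \<longlonglongrightarrow> (real a + 3)\<^sup>2 * 0 ^ (a + 1)"
      by (intro tendsto_intros x0)
    then have "\<forall>\<^sub>F n in sequentially. (real a + 3)\<^sup>2 * x n ^ (a + 1) < 1 / 8"
      by (rule order_tendstoD(2)) simp
    then have small: "\<forall>\<^sub>F n in sequentially. (real a + 3)\<^sup>2 * x n ^ (a + 1) \<le> 1 / 8"
      by (rule eventually_mono) (rule less_imp_le)
    have "\<forall>\<^sub>F n in sequentially. norm (f n)
      \<le> L * norm ((real n * p n) powr A + \<omega> n * real (m n) * (p n)\<^sup>2)"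
      using \<omega>_pos x_le assms(7)
    proof eventually_elim
      case (elim n)
      \<comment> \<open>\<open>d \<ge> 1\<close> excludes zero factors; positivity of
        \<open>x n\<close> is what allows the passage from natural powers to
        \<open>powr\<close>.\<close>
      have "p n \<noteq> 0" "n \<noteq> 0" using elim(3) by (auto intro!: Nat.gr0I)
      then have xp: "0 < x n"
        using order.not_eq_order_implies_strict[of 0 "p n"] assms(2)[of n] by (simp add: x_def)
      then have "x n ^ a = x n powr real a" by (simp add: powr_realpow)
      also have "\<dots> \<le> x n powr A" using a elim(2) xp by (intro powr_mono') auto
      finally have "x n ^ a + \<omega> n * real (m n) * (p n)\<^sup>2
          \<le> x n powr A + \<omega> n * real (m n) * (p n)\<^sup>2" by simp
      moreover have "0 \<le> x n ^ a + \<omega> n * real (m n) * (p n)\<^sup>2" using xp elim(1) by simp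
      ultimately show ?case using L by (simp add: f_def abs_mult x_def)
    qed
    then have "f \<in> O(\<lambda>n. (real n * p n) powr A + \<omega> n * real (m n) * (p n)\<^sup>2)"
      by (rule bigoI)
    moreover have "(\<lambda>n. measure_pmf.prob (random_intersection_graph n (m n) (p n))
        {G. modularity G \<le> 32 * (c + 2) / sqrt (real n * real (m n) * (p n)\<^sup>2) + f n}) \<longlonglongrightarrow> 1"
    proof (rule tendsto_sandwich[where h = "\<lambda>_. 1"])
      show "\<forall>\<^sub>F n in sequentially. 1 - ((2 * exp (- 2)) ^ n + exp (- 1 / (32 * (1 + 32 * c))) ^ n
            + (real a + 3)\<^sup>2 * x n + 1 / \<omega> n)
        \<le> measure_pmf.prob (random_intersection_graph n (m n) (p n))
          {G. modularity G \<le> 32 * (c + 2) / sqrt (real n * real (m n) * (p n)\<^sup>2) + f n}"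
        using \<omega>_pos x_le small assms(7) eventually_ge_at_top[of 2]
      proof eventually_elim
        case (elim n)
        then show ?case
          using prob_modularity_le[of n "p n" "m n" "\<omega> n" a] assms(2,3)[of n]
          unfolding f_def c_def L_def x_def by simp
      qed
      \<comment> \<open>From \<open>exp 2 \<ge> 3\<close> the ratio \<open>2 * exp (- 2)\<close>
        left by the union bound is below 1.\<close>
      have "exp (2 :: real) \<ge> 3" using exp_ge_add_one_self[of "2 :: real"] by simp
      then have "2 * exp (- 2 :: real) < 1" by (simp add: exp_minus field_simps)
      then have e1: "(\<lambda>n. (2 * exp (- 2 :: real)) ^ n) \<longlonglongrightarrow> 0"
        by (intro LIMSEQ_realpow_zero) auto
      have e2: "(\<lambda>n. exp (- 1 / (32 * (1 + 32 * c))) ^ n) \<longlonglongrightarrow> 0"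
        using c by (intro LIMSEQ_realpow_zero) (auto simp: divide_simps)
      have e3: "(\<lambda>n. 1 / \<omega> n) \<longlonglongrightarrow> 0"
        using tendsto_inverse_0_at_top[OF \<omega>] by (simp add: inverse_eq_divide)
      have "(\<lambda>n. 1 - ((2 * exp (- 2)) ^ n + exp (- 1 / (32 * (1 + 32 * c))) ^ n
            + (real a + 3)\<^sup>2 * x n + 1 / \<omega> n)) \<longlonglongrightarrow> 1 - (0 + 0 + (real a + 3)\<^sup>2 * 0 + 0)"
        by (intro tendsto_intros e1 e2 e3 x0)
      then show "(\<lambda>n. 1 - ((2 * exp (- 2)) ^ n + exp (- 1 / (32 * (1 + 32 * c))) ^ n
            + (real a + 3)\<^sup>2 * x n + 1 / \<omega> n)) \<longlonglongrightarrow> 1" by simp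
    qed simp_all
    ultimately show "\<exists>f. f \<in> O(\<lambda>n. (real n * p n) powr A + \<omega> n * real (m n) * (p n)\<^sup>2) \<and>
       (\<lambda>n. measure_pmf.prob (random_intersection_graph n (m n) (p n))
          {G. modularity G \<le> 32 * (c + 2) / sqrt (real n * real (m n) * (p n)\<^sup>2) + f n}) \<longlonglongrightarrow> 1"
      by blast
  qed
qed

end
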